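(* Let $\omega_1,\omega_3\in\mathbf{C}$ with $\mathrm{Im}(\omega_3/\omega_1)>0$, $\omega_0=0$, $\omega_2=\omega_1+\omega_3$, $\Lambda=\mathbf{Z}\omega_1+\mathbf{Z}\omega_3$, and let $\mathbf{T}=\mathbf{C}/\Lambda$. Let $m_0,\dots,m_3$ be positive integers and $n_j=(m_j-1)/2$. Consider a conformal metric of curvature $1$ on $\mathbf{T}$ whose only conic singularities are at $\omega_j/2$, $0\le j\le 3$, with total angle $2\pi m_j$ radians at $\omega_j/2$. Let $F:\mathbf{C}\to\overline{\mathbf{C}}$ be its developing map, and write its Schwarzian derivative as $$\frac{F'''}{F'}-\frac32\left(\frac{F''}{F'}\right)^2=-2\left(\sum_{j=0}^3 n_j(n_j+1)\wp(z-\omega_j/2)+\sum_{j=0}^3 b_j\zeta(z-\omega_j/2)+\lambda\right),\qquad \sum_{j=0}^3 b_j=0 .$$ Suppose that $b_j=0$ for $0\le j\le 3$. By post-composition with an element of $PSU(2)$ (which does not change the metric), $F$ may be normalized so that it satisfies either (A) $F(z+\omega_1)=-F(z)$ and $F(z+\omega_3)=1/F(z)$, or (B) $F(z+\omega_j)=e^{2\pi i\alpha_j}F(z)$ for $j=1,3$, with some real $\alpha_1,\alpha_3$. Then in case (A) the metric is even, that is, invariant under $z\mapsto -z$, while in case (B) the equivalence class of the metric contains an even metric.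
   Context: $\overline{\mathbf{C}}$ is the Riemann sphere; $\wp,\zeta$ are the Weierstrass functions of the lattice $\Lambda$. A conformal metric of curvature $1$ with conic singularities on a Riemann surface is given in a local conformal coordinate $z$ by a length element $\rho(z)|dz|$, where $u=\log\rho$ satisfies $\Delta u+e^{2u}=0$ away from the singularities, and $\rho(z)\sim c|z|^{\alpha-1}$ with $c>0$ near a singularity (placed at $z=0$) with total angle $2\pi\alpha$ radians, $\alpha>0$ (for $\alpha=1$ the point is in fact non-singular). The developing map is the analytic continuation of a local isometry to the standard unit sphere, so that $\rho=2|F'|/(1+|F|^2)$; it is defined up to post-composition with elements of $PSU(2)$ (rotations of the sphere). For the metrics on $\mathbf{T}$ considered here, all angles are integer multiples of $2\pi$ radians, so $F$ is a single-valued meromorphic function on $\mathbf{C}$, and its monodromy along the periods consists of elements of $PSU(2)$. Two metrics are called equivalent if their developing maps are related by post-composition with a linear-fractional transformation (an element of $PSL(2,\mathbf{C})$). *)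

theory Defs
  imports "HOL-Complex_Analysis.Complex_Analysis"
begin

definition lattice :: "complex \<Rightarrow> complex \<Rightarrow> complex set" where
  "lattice w1 w3 = {of_int k * w1 + of_int l * w3 | k l. True}"

definition weierstrass_p :: "complex set \<Rightarrow> complex \<Rightarrow> complex" where
  "weierstrass_p L z =
     1 / z\<^sup>2 + (\<Sum>\<^sub>\<infinity>w\<in>L - {0}. 1 / (z - w)\<^sup>2 - 1 / w\<^sup>2)"

definition weierstrass_zeta :: "complex set \<Rightarrow> complex \<Rightarrow> complex" where
  "weierstrass_zeta L z =
     1 / z + (\<Sum>\<^sub>\<infinity>w\<in>L - {0}. 1 / (z - w) + 1 / w + z / w\<^sup>2)"

definition schwarzian :: "(complex \<Rightarrow> complex) \<Rightarrow> complex \<Rightarrow> complex" where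
  "schwarzian f z =
     (deriv ^^ 3) f z / deriv f z - 3 / 2 * ((deriv ^^ 2) f z / deriv f z)\<^sup>2"

definition dir_deriv :: "complex \<Rightarrow> (complex \<Rightarrow> real) \<Rightarrow> complex \<Rightarrow> real" where
  "dir_deriv v u z = frechet_derivative u (at z) v"

(* The following two notions are meant for open sets U. *)
definition C1_on :: "complex set \<Rightarrow> (complex \<Rightarrow> real) \<Rightarrow> bool" where
  "C1_on U u \<longleftrightarrow>
     (\<forall>z\<in>U. u differentiable (at z)) \<and> (\<forall>v. continuous_on U (dir_deriv v u))"

definition C2_on :: "complex set \<Rightarrow> (complex \<Rightarrow> real) \<Rightarrow> bool" where
  "C2_on U u \<longleftrightarrow> C1_on U u \<and> (\<forall>v. C1_on U (dir_deriv v u))"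

definition laplacian :: "(complex \<Rightarrow> real) \<Rightarrow> complex \<Rightarrow> real" where
  "laplacian u z = dir_deriv 1 (dir_deriv 1 u) z + dir_deriv \<i> (dir_deriv \<i> u) z"

(* The length element rho(z)|dz| is a conformal metric of curvature 1 on the open set U. *)
definition curvature_one_on :: "complex set \<Rightarrow> (complex \<Rightarrow> real) \<Rightarrow> bool" where
  "curvature_one_on U \<rho> \<longleftrightarrow>
     (\<forall>z\<in>U. \<rho> z > 0) \<and> C2_on U (\<lambda>z. ln (\<rho> z)) \<and>
     (\<forall>z\<in>U. laplacian (\<lambda>z. ln (\<rho> z)) z + exp (2 * ln (\<rho> z)) = 0)"

(* Total angle 2 pi alpha at p; for alpha = 1 the point p is non-singular. *)
definition conic_point :: "(complex \<Rightarrow> real) \<Rightarrow> complex \<Rightarrow> real \<Rightarrow> bool" where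
  "conic_point \<rho> p \<alpha> \<longleftrightarrow>
     (\<exists>c>0. ((\<lambda>z. \<rho> z / norm (z - p) powr (\<alpha> - 1)) \<longlongrightarrow> c) (at p))"

(* The periods are given as omega j with omega 0 = 0 and omega 2 = omega 1 + omega 3.  This is the
   preimage in the complex plane of the four points (omega j) / 2 of the torus. *)
definition half_periods :: "(nat \<Rightarrow> complex) \<Rightarrow> complex set" where
  "half_periods \<omega> = {\<omega> j / 2 + l | j l. j \<le> 3 \<and> l \<in> lattice (\<omega> 1) (\<omega> 3)}"

(* Metrics on the torus are given by their pull-back to the complex plane, that is, by a
   periodic length element.  The values of rho at the points of half_periods are irrelevant. *)
definition torus_conic_metric ::
    "(nat \<Rightarrow> complex) \<Rightarrow> (nat \<Rightarrow> nat) \<Rightarrow> (complex \<Rightarrow> real) \<Rightarrow> bool" where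
  "torus_conic_metric \<omega> m \<rho> \<longleftrightarrow>
     (\<forall>z\<in>- half_periods \<omega>. \<forall>l\<in>lattice (\<omega> 1) (\<omega> 3). \<rho> (z + l) = \<rho> z) \<and>
     curvature_one_on (- half_periods \<omega>) \<rho> \<and>
     (\<forall>j\<le>3. conic_point \<rho> (\<omega> j / 2) (real (m j)))"

(* A meromorphic function, i.e. a holomorphic map to the Riemann sphere, is represented by
   the complex function that takes the value 0 at the poles and is continuous elsewhere.
   S is the set of singular points of the metric.  The formula says that F is a local
   isometry to the unit sphere away from S; at poles it follows by continuity. *)
definition developing_map ::
    "complex set \<Rightarrow> (complex \<Rightarrow> real) \<Rightarrow> (complex \<Rightarrow> complex) \<Rightarrow> bool" where
  "developing_map S \<rho> F \<longleftrightarrow> F nicely_meromorphic_on UNIV \<and>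
     (\<forall>z\<in>- S. \<not> is_pole F z \<longrightarrow> \<rho> z = 2 * norm (deriv F z) / (1 + (norm (F z))\<^sup>2))"

(* remove_sings restores the values at the poles of F, and assigns 0 at the new poles. *)
definition post_moebius ::
    "complex \<Rightarrow> complex \<Rightarrow> complex \<Rightarrow> complex \<Rightarrow> (complex \<Rightarrow> complex) \<Rightarrow> complex \<Rightarrow> complex" where
  "post_moebius a b c d F = remove_sings (\<lambda>z. moebius a b c d (F z))"

definition PSL2_related :: "(complex \<Rightarrow> complex) \<Rightarrow> (complex \<Rightarrow> complex) \<Rightarrow> bool" where
  "PSL2_related F G \<longleftrightarrow> (\<exists>a b c d. a * d - b * c = 1 \<and> G = post_moebius a b c d F)"

definition PSU2_related :: "(complex \<Rightarrow> complex) \<Rightarrow> (complex \<Rightarrow> complex) \<Rightarrow> bool" where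
  "PSU2_related F G \<longleftrightarrow>
     (\<exists>a b. (norm a)\<^sup>2 + (norm b)\<^sup>2 = 1 \<and> G = post_moebius a b (- cnj b) (cnj a) F)"

definition equivalent_metrics ::
    "complex set \<Rightarrow> (complex \<Rightarrow> real) \<Rightarrow> (complex \<Rightarrow> real) \<Rightarrow> bool" where
  "equivalent_metrics S \<rho> \<rho>' \<longleftrightarrow>
     (\<exists>F F'. developing_map S \<rho> F \<and> developing_map S \<rho>' F' \<and> PSL2_related F F')"

definition even_metric :: "complex set \<Rightarrow> (complex \<Rightarrow> real) \<Rightarrow> bool" where
  "even_metric S \<rho> \<longleftrightarrow> (\<forall>z\<in>- S. \<rho> (- z) = \<rho> z)"

(* With the value 0 at poles and 1 / 0 = 0, the pointwise equations below hold at all z if and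
   only if they hold as equations between maps to the Riemann sphere. *)
definition monodromy_A :: "(nat \<Rightarrow> complex) \<Rightarrow> (complex \<Rightarrow> complex) \<Rightarrow> bool" where
  "monodromy_A \<omega> F \<longleftrightarrow> (\<forall>z. F (z + \<omega> 1) = - F z \<and> F (z + \<omega> 3) = 1 / F z)"

definition monodromy_B :: "(nat \<Rightarrow> complex) \<Rightarrow> (complex \<Rightarrow> complex) \<Rightarrow> bool" where
  "monodromy_B \<omega> F \<longleftrightarrow>
     (\<exists>\<alpha> :: nat \<Rightarrow> real. \<forall>j\<in>{1, 3}. \<forall>z.
        F (z + \<omega> j) = exp (2 * of_real pi * \<i> * of_real (\<alpha> j)) * F z)"

end

theory Submission
  imports Defs
begin

text \<open>
  Since \<open>b\<^sub>j = 0\<close>, the Schwarzian derivative of \<open>F\<close> is an even elliptic function, and functions with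
  the same Schwarzian derivative differ by a Moebius transformation. So \<open>F(z + \<omega>\<^sub>j) = A\<^sub>j F(z)\<close> and
  \<open>F(-z) = M F(z)\<close>; the \<open>A\<^sub>j\<close> preserve the length element, hence are unitary, and they commute
  up to sign, which gives the normal forms (A) and (B). In case (A) the transformation \<open>M\<close>
  commutes with \<open>w \<mapsto> -w\<close> and \<open>w \<mapsto> 1/w\<close>, so it belongs to the Klein four-group generated by these
  rotations, and the metric is even. In case (B), and in fact always, the length element
  \<open>1 / (1 / \<rho>(z) + 1 / \<rho>(-z))\<close> is even and periodic; up to a constant factor, it is the pull-back
  of the spherical metric by \<open>B F\<close> with \<open>B\<^sup>* B\<close> proportional to \<open>I + M\<^sup>* M\<close>.
\<close>

section \<open>The Weierstrass function of a lattice\<close>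

text \<open>Why reciprocals of length elements are added: the transform of \<open>F\<close> by a
  matrix \<open>B\<close> of determinant 1 has length element \<open>2 |F'| / h(F, 1)\<close>, where
  \<open>h\<close> is the positive definite Hermitian form of \<open>B\<^sup>* B\<close>. Thus
  \<open>1 / \<rho>\<close> is linear in the form, and a sum of two such forms is again of this kind
  after division by the square root of its determinant, which is the constant factor. The same form
  explains unitarity: equal length elements mean \<open>B\<^sup>* B = I\<close>. In case (A) the
  constraints on \<open>M\<close> leave only unitary matrices; in case (B) they are compatible with
  non-unitary \<open>M\<close>, hence the passage to another metric of the class. The sign in the
  commutation of \<open>A\<^sub>1\<close> and \<open>A\<^sub>3\<close> arises because a Moebius map
  determines its matrix of determinant 1 only up to sign. The obstacle that shapes the formal proof
  is the point at infinity: relations between maps to the sphere are stated off a closed discrete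
  set, where they are identities of complex numbers, and continuity restores the pointwise
  statements.\<close>

lemma lattice_norm_bound:
  fixes w1 w3 :: complex
  assumes "Im (w3 / w1) > 0"
  obtains c where "c > 0"
    "\<And>k l :: int. real_of_int (\<bar>k\<bar> + \<bar>l\<bar>) \<le> c * norm (of_int k * w1 + of_int l * w3)"
proof -
  define t where "t = w3 / w1"
  have t: "Im t > 0" and w1: "w1 \<noteq> 0" using assms by (auto simp: t_def)
  \<comment> \<open>Division by \<open>w1\<close> turns the second generator into \<open>t\<close>.
    Then \<open>|l|\<close> is at most \<open>|x| / Im t\<close> and \<open>|k|\<close> at most
    \<open>|x| + |l| |t|\<close>; \<open>C\<close> adds up the two bounds.\<close>
  define C where "C = 1 + (norm t + 1) / Im t"
  have C: "C > 0" using t by (auto simp: C_def intro!: add_pos_nonneg)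
  have "real_of_int (\<bar>k\<bar> + \<bar>l\<bar>) \<le> C / norm w1 * norm (of_int k * w1 + of_int l * w3)" for k l :: int
  proof -
    define x where "x = of_int k + of_int l * t"
    have w: "of_int k * w1 + of_int l * w3 = w1 * x" using w1 by (simp add: x_def t_def field_simps)
    have "\<bar>real_of_int l\<bar> * Im t = \<bar>Im x\<bar>" using t by (simp add: x_def abs_mult)
    also have "\<dots> \<le> norm x" by (rule abs_Im_le_cmod)
    finally have l: "\<bar>real_of_int l\<bar> \<le> norm x / Im t" using t by (simp add: field_simps)
    have "\<bar>real_of_int k\<bar> = norm (x - of_int l * t)" by (simp add: x_def)
    also have "\<dots> \<le> norm x + \<bar>real_of_int l\<bar> * norm t"
      by (metis norm_triangle_ineq4 norm_mult norm_of_int)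
    also have "\<dots> \<le> norm x + norm x / Im t * norm t"
      by (intro add_left_mono mult_right_mono l) auto
    finally have "real_of_int (\<bar>k\<bar> + \<bar>l\<bar>) \<le> norm x + norm x / Im t * norm t + norm x / Im t"
      using l by simp
    also have "\<dots> = C * norm x" using t by (simp add: C_def field_simps)
    finally show ?thesis using w1 by (simp add: w norm_mult)
  qed
  moreover have "C / norm w1 > 0" using C w1 by simp
  ultimately show ?thesis using that by blast
qed

lemma finite_lattice_cball:
  fixes w1 w3 :: complex
  assumes "Im (w3 / w1) > 0"
  shows "finite {w \<in> lattice w1 w3. norm w \<le> R}"
proof -
  obtain c where c: "c > 0"
    "\<And>k l :: int. real_of_int (\<bar>k\<bar> + \<bar>l\<bar>) \<le> c * norm (of_int k * w1 + of_int l * w3)"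
    using lattice_norm_bound[OF assms] by blast
  define N where "N = \<lfloor>c * R\<rfloor>"
  have "{w \<in> lattice w1 w3. norm w \<le> R} \<subseteq>
      (\<lambda>(k, l). of_int k * w1 + of_int l * w3) ` ({-N..N} \<times> {-N..N})"
  proof
    fix w assume "w \<in> {w \<in> lattice w1 w3. norm w \<le> R}"
    then obtain k l where w: "w = of_int k * w1 + of_int l * w3" "norm w \<le> R"
      by (auto simp: lattice_def)
    have "real_of_int (\<bar>k\<bar> + \<bar>l\<bar>) \<le> c * norm w" using c w by simp
    also have "\<dots> \<le> c * R" using c w by simp
    finally have "\<bar>k\<bar> + \<bar>l\<bar> \<le> N" unfolding N_def by linarith
    hence "(k, l) \<in> {-N..N} \<times> {-N..N}" by auto
    thus "w \<in> (\<lambda>(k, l). of_int k * w1 + of_int l * w3) ` ({-N..N} \<times> {-N..N})"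
      using w by force
  qed
  thus ?thesis by (rule finite_subset) auto
qed

lemma sparse_lattice:
  fixes w1 w3 :: complex
  assumes "Im (w3 / w1) > 0"
  shows "lattice w1 w3 sparse_in UNIV"
proof -
  have "\<not> y islimpt lattice w1 w3" for y
  proof
    assume "y islimpt lattice w1 w3"
    hence "infinite (lattice w1 w3 \<inter> ball y 1)"
      by (simp add: islimpt_eq_infinite_ball)
    moreover have "lattice w1 w3 \<inter> ball y 1 \<subseteq> {w \<in> lattice w1 w3. norm w \<le> norm y + 1}"
      by (auto simp: dist_norm) (smt (verit) norm_minus_commute norm_triangle_ineq2)
    ultimately show False using finite_lattice_cball[OF assms] finite_subset by blast
  qed
  thus ?thesis by (simp add: sparse_in_open)
qed

section \<open>Convergence of the Weierstrass series\<close>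

text \<open>The exponent is half of the 3 that occurs over the lattice: the double sum is dominated
  by a product of two such single sums, and \<open>3/2\<close> still exceeds 1.\<close>

lemma summable_on_int_powr:
  "(\<lambda>k::int. (1 + \<bar>real_of_int k\<bar>) powr (-3/2)) summable_on UNIV" (is "?f summable_on _")
proof -
  have "summable (\<lambda>n. real (Suc n) powr (-3/2))"
    by (subst summable_Suc_iff) (simp add: summable_real_powr_iff)
  hence nat: "(\<lambda>n. real (Suc n) powr (-3/2)) summable_on UNIV"
    by (intro norm_summable_imp_summable_on) simp
  have "?f summable_on range int"
    by (subst summable_on_reindex) (use nat in \<open>auto simp: o_def algebra_simps\<close>)
  moreover have "?f summable_on range (\<lambda>n. - int n)"
    by (subst summable_on_reindex) (use nat in \<open>auto simp: o_def inj_on_def algebra_simps\<close>)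
  moreover have "(UNIV :: int set) = range int \<union> (range (\<lambda>n. - int n) - range int)"
    by (auto, metis int_cases2 rangeI)
  ultimately show ?thesis
    by (metis (no_types, lifting) Diff_disjoint Diff_subset summable_on_Un_disjoint summable_on_subset_banach)
qed

lemma summable_on_lattice_cube:
  fixes w1 w3 :: complex
  assumes "Im (w3 / w1) > 0"
  shows "(\<lambda>w. 1 / norm w ^ 3) summable_on lattice w1 w3"
proof -
  obtain c where c: "c > 0"
    "\<And>k l :: int. real_of_int (\<bar>k\<bar> + \<bar>l\<bar>) \<le> c * norm (of_int k * w1 + of_int l * w3)"
    using lattice_norm_bound[OF assms] by blast
  define f where "f = (\<lambda>k::int. (1 + \<bar>real_of_int k\<bar>) powr (-3/2))"
  have f: "f summable_on UNIV" unfolding f_def by (rule summable_on_int_powr)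
  have f0: "f k \<ge> 0" for k by (simp add: f_def)
  define p where "p = (\<lambda>(k, l). of_int k * w1 + of_int l * w3)"
  have inj: "inj p"
  proof (rule injI)
    fix x y assume "p x = p y"
    hence "of_int (fst x - fst y) * w1 + of_int (snd x - snd y) * w3 = 0"
      by (simp add: p_def case_prod_beta algebra_simps)
    hence "real_of_int (\<bar>fst x - fst y\<bar> + \<bar>snd x - snd y\<bar>) \<le> 0"
      using c(2)[of "fst x - fst y" "snd x - snd y"] by (metis mult_zero_right norm_zero)
    thus "x = y" by (auto simp: prod_eq_iff)
  qed
  have "(\<lambda>x. norm (f (fst x) * f (snd x))) summable_on (UNIV \<times> UNIV)"
    using f f0
    by (intro Infinite_Sum.abs_summable_on_Sigma_iff[THEN iffD2]) (auto simp: abs_mult infsum_cmult_right' infsum_nonneg intro!: summable_on_cmult_right summable_on_cmult_left)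
  hence ff: "(\<lambda>x. (8 * c ^ 3) * (f (fst x) * f (snd x))) summable_on UNIV"
    by (intro summable_on_cmult_right) (simp add: abs_mult f0)
  have bound: "1 / norm (p x) ^ 3 \<le> 8 * c ^ 3 * (f (fst x) * f (snd x))" for x
  \<comment> \<open>At the origin the term is \<open>1 / 0 = 0\<close>, so that the sum may run over
    the whole lattice.\<close>
  proof (cases "x = (0, 0)")
    case True
    thus ?thesis using c by (simp add: p_def f_def)
  next
    case False
    define k l where "k = \<bar>real_of_int (fst x)\<bar>" and "l = \<bar>real_of_int (snd x)\<bar>"
    define s where "s = k + l"
    have kl: "k \<ge> 0" "l \<ge> 0" by (auto simp: k_def l_def)
    have "fst x \<noteq> 0 \<or> snd x \<noteq> 0" using False by (auto simp: prod_eq_iff)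
    hence "1 \<le> \<bar>fst x\<bar> + \<bar>snd x\<bar>" by linarith
    hence s1: "s \<ge> 1" unfolding s_def k_def l_def by linarith
    have sc: "s \<le> c * norm (p x)" using c(2)[of "fst x" "snd x"]
      by (simp add: s_def k_def l_def p_def case_prod_beta)
    \<comment> \<open>Since \<open>s \<ge> 1\<close>, both factors are at most \<open>2 * s\<close>;
      raising to the power \<open>3/2\<close> gives the constant \<open>8 = 2^3\<close>.\<close>
    have "(1 + k) * (1 + l) \<le> (2 * s) * (2 * s)"
      by (rule mult_mono) (use kl s1 in \<open>auto simp: s_def\<close>)
    hence "((1 + k) * (1 + l)) powr (3/2) \<le> ((2 * s) powr 2) powr (3/2)"
      by (intro powr_mono2) (use kl s1 in \<open>auto simp: power2_eq_square\<close>)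
    also have "\<dots> = (2 * s) powr 3" by (subst powr_powr) simp
    also have "\<dots> = (2 * s) ^ 3" using s1 by (intro powr_numeral) auto
    also have "\<dots> = 8 * s ^ 3" by (simp add: power_mult_distrib)
    also have "\<dots> \<le> 8 * (c * norm (p x)) ^ 3"
      by (intro mult_left_mono power_mono sc) (use s1 in auto)
    finally have *: "((1 + k) * (1 + l)) powr (3/2) \<le> 8 * c ^ 3 * norm (p x) ^ 3"
      by (simp add: power_mult_distrib)
    have pos: "((1 + k) * (1 + l)) powr (3/2) > 0" using kl by (simp add: add_pos_nonneg)
    have px: "norm (p x) > 0" using sc s1 c(1)
      by (metis less_eq_real_def mult_zero_right norm_ge_zero not_one_le_zero order_trans)
    define Q where "Q = ((1 + k) * (1 + l)) powr (3/2)"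
    have "f (fst x) * f (snd x) = 1 / Q"
      using kl by (simp add: f_def k_def l_def Q_def powr_minus_divide powr_mult)
    moreover have "1 / norm (p x) ^ 3 \<le> 8 * c ^ 3 * (1 / Q)"
      using * pos px unfolding Q_def[symmetric] by (simp add: field_simps)
    ultimately show ?thesis by simp
  qed
  have "(\<lambda>x. 1 / norm (p x) ^ 3) summable_on UNIV"
    by (rule summable_on_comparison_test[OF ff]) (use bound in auto)
  hence "(\<lambda>w. 1 / norm w ^ 3) summable_on range p"
    by (subst summable_on_reindex[OF inj]) (simp add: o_def)
  moreover have "range p = lattice w1 w3" by (auto simp: p_def lattice_def)
  ultimately show ?thesis by simp
qed

text \<open>Outside the disc of radius \<open>2 |z|\<close> the terms are at most
  \<open>10 |z| / |w|^3\<close>, where 10 is \<open>5/2\<close> from the numerator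
  \<open>2 * w - z\<close> times 4 from \<open>|z - w| \<ge> |w| / 2\<close>. The disc contains only
  finitely many lattice points, which are split off.\<close>

lemma summable_on_weierstrass_p:
  fixes w1 w3 z :: complex
  assumes "Im (w3 / w1) > 0"
  shows "(\<lambda>w. 1 / (z - w)\<^sup>2 - 1 / w\<^sup>2) summable_on lattice w1 w3"
proof -
  let ?L = "lattice w1 w3"
  define B where "B = {w \<in> ?L. norm w \<le> 2 * norm z}"
  have finB: "finite B" unfolding B_def by (rule finite_lattice_cball[OF assms])
  have sum: "(\<lambda>w. 10 * norm z * (1 / norm w ^ 3)) summable_on ?L - B"
    by (intro summable_on_cmult_right summable_on_subset_banach[OF summable_on_lattice_cube[OF assms]]) auto
  have "(\<lambda>w. norm (1 / (z - w)\<^sup>2 - 1 / w\<^sup>2)) summable_on ?L - B"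
  proof (rule summable_on_comparison_test[OF sum])
    fix w assume "w \<in> ?L - B"
    hence w: "norm w > 2 * norm z" by (auto simp: B_def)
    hence w0: "norm w > 0" by (smt (verit) norm_ge_zero)
    have zw: "norm (z - w) \<ge> norm w / 2" using norm_triangle_ineq2[of w z] w
      by (simp add: norm_minus_commute)
    hence zw0: "norm (z - w) > 0" using w0 by linarith
    have w00: "w \<noteq> 0" "z - w \<noteq> 0" using w0 zw0 by force+
    have "1 / (z - w)\<^sup>2 - 1 / w\<^sup>2 = z * (2 * w - z) / (w\<^sup>2 * (z - w)\<^sup>2)"
      using w00 by (simp add: diff_frac_eq) (simp add: algebra_simps power2_eq_square)
    hence "norm (1 / (z - w)\<^sup>2 - 1 / w\<^sup>2) = norm z * norm (2 * w - z) / ((norm w)\<^sup>2 * (norm (z - w))\<^sup>2)"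
      by (simp add: norm_mult norm_divide norm_power)
    also have "\<dots> \<le> norm z * (5 / 2 * norm w) / ((norm w)\<^sup>2 * (norm w / 2)\<^sup>2)"
    proof (rule frac_le)
      have "norm (2 * w - z) \<le> 2 * norm w + norm z"
        by (metis norm_mult norm_numeral norm_triangle_ineq4)
      thus "norm z * norm (2 * w - z) \<le> norm z * (5 / 2 * norm w)"
        by (intro mult_left_mono) (use w in auto)
      show "(norm w)\<^sup>2 * (norm w / 2)\<^sup>2 \<le> (norm w)\<^sup>2 * (norm (z - w))\<^sup>2"
        using zw w0 by (intro mult_left_mono power_mono) auto
    qed (use w0 in auto)
    also have "\<dots> = 10 * norm z * (1 / norm w ^ 3)"
      using w0 by (simp add: field_simps power2_eq_square power3_eq_cube)
    finally show "norm (1 / (z - w)\<^sup>2 - 1 / w\<^sup>2) \<le> 10 * norm z * (1 / norm w ^ 3)" .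
  qed auto
  hence "(\<lambda>w. 1 / (z - w)\<^sup>2 - 1 / w\<^sup>2) summable_on ?L - B" by (rule abs_summable_summable)
  moreover have "(\<lambda>w. 1 / (z - w)\<^sup>2 - 1 / w\<^sup>2) summable_on B" using finB by simp
  ultimately have "(\<lambda>w. 1 / (z - w)\<^sup>2 - 1 / w\<^sup>2) summable_on (?L - B) \<union> B"
    by (rule summable_on_Un_disjoint) auto
  moreover have "(?L - B) \<union> B = ?L" by (auto simp: B_def)
  ultimately show ?thesis by simp
qed

section \<open>Group structure of the lattice, and symmetries of the Weierstrass function\<close>

lemma lattice_0 [simp]: "0 \<in> lattice w1 w3"
  unfolding lattice_def by (force intro: exI[of _ 0])

lemma lattice_add: "x \<in> lattice w1 w3 \<Longrightarrow> y \<in> lattice w1 w3 \<Longrightarrow> x + y \<in> lattice w1 w3"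
  unfolding lattice_def mem_Collect_eq
  by (elim exE, rename_tac k k' l l', rule_tac x = "k + k'" in exI, rule_tac x = "l + l'" in exI)
     (auto simp: algebra_simps)

lemma lattice_uminus: "x \<in> lattice w1 w3 \<Longrightarrow> - x \<in> lattice w1 w3"
  unfolding lattice_def mem_Collect_eq
  by (elim exE, rename_tac k l, rule_tac x = "- k" in exI, rule_tac x = "- l" in exI) auto

lemma lattice_diff: "x \<in> lattice w1 w3 \<Longrightarrow> y \<in> lattice w1 w3 \<Longrightarrow> x - y \<in> lattice w1 w3"
  using lattice_add[of x w1 w3 "- y"] lattice_uminus[of y] by simp

lemma lattice_generators: "w1 \<in> lattice w1 w3" "w3 \<in> lattice w1 w3"
  unfolding lattice_def mem_Collect_eq
  by (rule exI[of _ 1], rule exI[of _ 0], simp) (rule exI[of _ 0], rule exI[of _ 1], simp)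

text \<open>Since \<open>1 / 0 = 0\<close>, the term of index \<open>0\<close> is the principal part.\<close>
lemma weierstrass_p_altdef:
  fixes w1 w3 z :: complex
  assumes "Im (w3 / w1) > 0"
  shows "weierstrass_p (lattice w1 w3) z = (\<Sum>\<^sub>\<infinity>w\<in>lattice w1 w3. 1 / (z - w)\<^sup>2 - 1 / w\<^sup>2)"
proof -
  let ?L = "lattice w1 w3" and ?f = "\<lambda>w. 1 / (z - w)\<^sup>2 - 1 / w\<^sup>2"
  have "infsum ?f ({0} \<union> (?L - {0})) = infsum ?f {0} + infsum ?f (?L - {0})"
    by (intro infsum_Un_disjoint summable_on_subset_banach[OF summable_on_weierstrass_p[OF assms]]) auto
  moreover have "{0} \<union> (?L - {0}) = ?L" by auto
  ultimately show ?thesis by (simp add: weierstrass_p_def)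
qed

text \<open>Shifting the index by \<open>p\<close> shows that the two values differ by a constant
  \<open>C\<close> independent of \<open>z\<close>, and the reflection
  \<open>w \<mapsto> - w - p\<close> of the lattice turns \<open>C\<close> into \<open>- C\<close>.
  This uses only summability, no differentiation of the series, and covers the lattice points with
  their values from \<open>1 / 0 = 0\<close>.\<close>

lemma weierstrass_p_periodic:
  fixes w1 w3 z :: complex
  assumes "Im (w3 / w1) > 0" and p: "p \<in> lattice w1 w3"
  shows "weierstrass_p (lattice w1 w3) (z + p) = weierstrass_p (lattice w1 w3) z"
proof -
  let ?L = "lattice w1 w3"
  note s = summable_on_weierstrass_p[OF assms(1)]
  have shift: "weierstrass_p ?L (z + p) = (\<Sum>\<^sub>\<infinity>w\<in>?L. 1 / (z - w)\<^sup>2 - 1 / (w + p)\<^sup>2)"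
  and s': "(\<lambda>w. 1 / (z - w)\<^sup>2 - 1 / (w + p)\<^sup>2) summable_on ?L" for z
  proof -
    have bij: "bij_betw (\<lambda>w. w + p) ?L ?L"
      by (rule bij_betwI[of _ _ _ "\<lambda>w. w - p"]) (use p in \<open>auto intro: lattice_add lattice_diff\<close>)
    show "weierstrass_p ?L (z + p) = (\<Sum>\<^sub>\<infinity>w\<in>?L. 1 / (z - w)\<^sup>2 - 1 / (w + p)\<^sup>2)"
      unfolding weierstrass_p_altdef[OF assms(1)]
      by (subst infsum_reindex_bij_betw[OF bij, symmetric]) simp
    show "(\<lambda>w. 1 / (z - w)\<^sup>2 - 1 / (w + p)\<^sup>2) summable_on ?L"
      using s[of "z + p"] by (subst (asm) summable_on_reindex_bij_betw[OF bij, symmetric]) simp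
  qed
  define C where "C = (\<Sum>\<^sub>\<infinity>w\<in>?L. 1 / w\<^sup>2 - 1 / (w + p)\<^sup>2)"
  have diff: "weierstrass_p ?L (z + p) - weierstrass_p ?L z = C"
    using infsum_add[OF s'[of z] summable_on_uminus[THEN iffD2, OF s[of z]]] infsum_uminus[of "\<lambda>w. 1 / (z - w)\<^sup>2 - 1 / w\<^sup>2" ?L]
    unfolding shift unfolding weierstrass_p_altdef[OF assms(1)] C_def by simp
  have bij: "bij_betw (\<lambda>w. - w - p) ?L ?L"
    by (rule bij_betwI[of _ _ _ "\<lambda>w. - w - p"])
       (use p in \<open>auto intro: lattice_diff lattice_uminus\<close>)
  have "C = (\<Sum>\<^sub>\<infinity>w\<in>?L. 1 / (- w - p)\<^sup>2 - 1 / (- w)\<^sup>2)"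
    unfolding C_def by (subst infsum_reindex_bij_betw[OF bij, symmetric]) simp
  also have "(\<lambda>w. 1 / (- w - p)\<^sup>2 - 1 / (- w)\<^sup>2) = (\<lambda>w. - (1 / w\<^sup>2 - 1 / (w + p)\<^sup>2))"
    by (auto simp: fun_eq_iff power2_eq_square algebra_simps)
  also have "(\<Sum>\<^sub>\<infinity>w\<in>?L. - (1 / w\<^sup>2 - 1 / (w + p)\<^sup>2)) = - C"
    unfolding C_def by (rule infsum_uminus)
  finally show ?thesis using diff by simp
qed

lemma weierstrass_p_even:
  fixes w1 w3 z :: complex
  assumes "Im (w3 / w1) > 0"
  shows "weierstrass_p (lattice w1 w3) (- z) = weierstrass_p (lattice w1 w3) z"
proof -
  have bij: "bij_betw uminus (lattice w1 w3) (lattice w1 w3)"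
    by (rule bij_betwI[of _ _ _ uminus]) (auto intro: lattice_uminus)
  have "(- z + w)\<^sup>2 = (z - w)\<^sup>2" for w by (simp add: power2_eq_square algebra_simps)
  thus ?thesis unfolding weierstrass_p_altdef[OF assms]
    by (subst infsum_reindex_bij_betw[OF bij, symmetric]) simp
qed

section \<open>Equality almost everywhere and Moebius transformations\<close>

text \<open>The exceptional set is closed and discrete. It absorbs poles, critical points and conic
  points, and it meets every point only through a punctured neighbourhood, so that limits do not see
  it.\<close>

abbreviation almost_everywhere :: "(complex \<Rightarrow> bool) \<Rightarrow> bool" where
  "almost_everywhere P \<equiv> eventually P (cosparse UNIV)"

lemma ae_iff: "almost_everywhere P \<longleftrightarrow> (\<forall>z. eventually P (at z))"
  by (simp add: eventually_cosparse_open_eq)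

lemma ae_at: "almost_everywhere P \<Longrightarrow> eventually P (at z)"
  by (simp add: ae_iff)

text \<open>The exceptional set is closed, so a property off it holds on neighbourhoods. This is
  what permits differentiating an identity that holds almost everywhere.\<close>

lemma ae_nhds:
  assumes "almost_everywhere P"
  shows "almost_everywhere (\<lambda>z. eventually P (nhds z))"
  using assms
proof (rule eventually_mono)
  fix z assume "P z"
  moreover have "closed {z. \<not> P z}"
    using assms by (intro sparse_in_UNIV_imp_closed) (simp add: eventually_cosparse)
  hence "open (- {z. \<not> P z})" by (simp add: closed_def)
  moreover have "- {z. \<not> P z} = {z. P z}" by auto
  ultimately show "eventually P (nhds z)"
    unfolding eventually_nhds by (metis mem_Collect_eq)
qed

lemma ae_affine:
  assumes "almost_everywhere P" "u \<noteq> 0"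
  shows "almost_everywhere (\<lambda>z. P (u * z + c))"
  unfolding ae_iff
proof
  fix z
  have "filterlim (\<lambda>z. u * z + c) (at (u * z + c)) (at z)"
    by (rule filterlim_atI) (use assms(2) in \<open>auto intro!: tendsto_intros simp: eventually_at_filter\<close>)
  thus "\<forall>\<^sub>F z in at z. P (u * z + c)"
    using ae_at[OF assms(1)] by (rule eventually_compose_filterlim[rotated])
qed

lemma ae_eq_imp_eq:
  fixes f g :: "complex \<Rightarrow> 'a::t2_space"
  assumes "isCont f z" "isCont g z" "eventually (\<lambda>z. f z = g z) (at z)"
  shows "f z = g z"
proof -
  have "f \<midarrow>z\<rightarrow> g z"
    using assms(2) tendsto_cong[OF assms(3)] by (simp add: isCont_def)
  thus ?thesis using assms(1) unfolding isCont_def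
    by (metis tendsto_unique trivial_limit_at)
qed

text \<open>Punctured neighbourhoods determine the poles, where both values are 0 by convention, and
  continuity decides elsewhere. Hence relations off a discrete set yield the pointwise equations of
  the monodromy conditions.\<close>

lemma nicely_meromorphic_ae_eq:
  assumes "f nicely_meromorphic_on UNIV" "g nicely_meromorphic_on UNIV"
    and "almost_everywhere (\<lambda>z. f z = g z)"
  shows "f = g"
proof
  fix z
  have ev: "eventually (\<lambda>z. f z = g z) (at z)" using assms(3) by (rule ae_at)
  have pole: "is_pole f z \<longleftrightarrow> is_pole g z" by (rule is_pole_cong[OF ev refl])
  show "f z = g z"
  proof (cases "is_pole f z")
    case True
    thus ?thesis using pole assms(1,2) is_pole_zero_at_nicely_mero by (metis UNIV_I)
  next
    case False
    hence "isCont f z" "isCont g z"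
      using pole assms(1,2) nicely_meromorphic_on_imp_analytic_at analytic_at_imp_isCont by blast+
    thus ?thesis by (rule ae_eq_imp_eq[OF _ _ ev])
  qed
qed

section \<open>Nonconstant meromorphic functions and their values\<close>

text \<open>For meromorphic functions this amounts to \<open>F\<close> not being constant off a
  discrete set. The form with the derivative is the one needed for the Schwarzian and for local
  inverses.\<close>

definition loc_injective :: "(complex \<Rightarrow> complex) \<Rightarrow> bool" where
  "loc_injective F \<longleftrightarrow> F meromorphic_on UNIV \<and> almost_everywhere (\<lambda>z. deriv F z \<noteq> 0)"

text \<open>Near a point where \<open>F\<close> is holomorphic with nonzero derivative,
  \<open>F\<close> is an open map. An identity in \<open>F z\<close> thereby becomes an identity in
  a free variable \<open>w\<close>, whose coefficients can be compared.\<close>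

lemma loc_injective_open_values:
  assumes F: "loc_injective F" and P: "almost_everywhere (\<lambda>z. P (F z))"
  obtains W where "open W" "W \<noteq> {}" "\<And>w. w \<in> W \<Longrightarrow> P w"
proof -
  have "almost_everywhere (\<lambda>z. F analytic_on {z} \<and> deriv F z \<noteq> 0 \<and> P (F z))"
    using F P by (auto simp: loc_injective_def intro!: eventually_conj meromorphic_on_imp_analytic_cosparse)
  from ae_nhds[OF this] obtain z where "\<forall>\<^sub>F w in nhds z. F analytic_on {w} \<and> deriv F w \<noteq> 0 \<and> P (F w)"
    by (rule eventually_happens'[rotated, elim_format]) auto
  then obtain U where U: "open U" "z \<in> U" "\<And>w. w \<in> U \<Longrightarrow> F analytic_on {w} \<and> deriv F w \<noteq> 0 \<and> P (F w)"
    unfolding eventually_nhds by blast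
  have hol: "F holomorphic_on U"
    using U by (meson analytic_imp_holomorphic analytic_on_analytic_at)
  obtain r where r: "r > 0" "ball z r \<subseteq> U" "inj_on F (ball z r)"
    using has_complex_derivative_locally_injective[OF hol U(2,1)] U by blast
  show ?thesis
  proof (rule that)
    show "open (F ` ball z r)"
      by (rule open_mapping_thm3) (use r hol in \<open>auto intro: holomorphic_on_subset\<close>)
  qed (use r U in auto)
qed

lemma loc_injective_avoid:
  assumes "loc_injective F"
  shows "almost_everywhere (\<lambda>z. F z \<noteq> w)"
proof -
  have False if ae: "almost_everywhere (\<lambda>z. F z = w)"
  proof -
    obtain W where "open W" "W \<noteq> {}" "\<And>v. v \<in> W \<Longrightarrow> v = w"
      using loc_injective_open_values[where P = "\<lambda>v. v = w", OF assms ae] by blast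
    hence "W = {w}" by blast
    thus False using \<open>open W\<close> not_open_singleton by blast
  qed
  thus ?thesis
    using meromorphic_imp_constant_or_avoid[of F UNIV w] assms by (auto simp: loc_injective_def)
qed

lemma loc_injective_linear_avoid:
  assumes "loc_injective F" "c \<noteq> 0 \<or> d \<noteq> 0"
  shows "almost_everywhere (\<lambda>z. c * F z + d \<noteq> 0)"
proof (cases "c = 0")
  case False
  show ?thesis
    by (rule eventually_mono[OF loc_injective_avoid[OF assms(1), of "- d / c"]])
       (use False in \<open>auto simp: field_simps add_eq_0_iff2\<close>)
qed (use assms in auto)

section \<open>Moebius relations off a discrete set\<close>

text \<open>The matrix with rows \<open>(a, b)\<close> and \<open>(c, d)\<close> carries
  \<open>F\<close> to \<open>G\<close> as maps to the sphere. Requiring a nonzero denominator keeps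
  the formula free of division by zero, and composition becomes matrix multiplication with the later
  factor on the left. The determinant is stated separately where it is used.\<close>

definition moebius_related ::
    "complex \<Rightarrow> complex \<Rightarrow> complex \<Rightarrow> complex \<Rightarrow> (complex \<Rightarrow> complex) \<Rightarrow> (complex \<Rightarrow> complex) \<Rightarrow> bool" where
  "moebius_related a b c d F G \<longleftrightarrow>
     almost_everywhere (\<lambda>z. c * F z + d \<noteq> 0 \<and> G z = (a * F z + b) / (c * F z + d))"

lemma moebius_related_compose:
  assumes "moebius_related a b c d F G" "moebius_related a' b' c' d' G H"
  shows "moebius_related (a' * a + b' * c) (a' * b + b' * d) (c' * a + d' * c) (c' * b + d' * d) F H"
  using assms unfolding moebius_related_def
proof (rule eventually_elim2, goal_cases)
  case (1 z)
  define w where "w = c * F z + d"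
  have w: "w \<noteq> 0" using 1 by (simp add: w_def)
  have G: "G z = (a * F z + b) / w" using 1 by (simp add: w_def)
  have den: "(c' * a + d' * c) * F z + (c' * b + d' * d) = w * (c' * G z + d')"
    using w by (simp add: G field_simps) (simp add: w_def algebra_simps)
  have num: "(a' * a + b' * c) * F z + (a' * b + b' * d) = w * (a' * G z + b')"
    using w by (simp add: G field_simps) (simp add: w_def algebra_simps)
  show ?case unfolding den num using 1 w by simp
qed

lemma moebius_related_inverse:
  assumes "moebius_related a b c d F G" "a * d - b * c = 1"
  shows "moebius_related d (- b) (- c) a G F"
  using assms(1) unfolding moebius_related_def
proof (rule eventually_mono, goal_cases)
  case (1 z)
  define w where "w = c * F z + d"
  have w: "w \<noteq> 0" using 1 by (simp add: w_def)
  have G: "G z = (a * F z + b) / w" using 1 by (simp add: w_def)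
  have "w * (- c * G z + a) = a * d - b * c" "w * (d * G z - b) = (a * d - b * c) * F z"
    using w by (simp_all add: G field_simps) (simp_all add: w_def algebra_simps)
  hence *: "- c * G z + a = 1 / w" "d * G z - b = F z / w"
    using w assms(2) by (simp_all add: field_simps)
  show ?case using w * by simp
qed

lemma moebius_related_affine:
  assumes "moebius_related a b c d F G" "u \<noteq> 0"
  shows "moebius_related a b c d (\<lambda>z. F (u * z + e)) (\<lambda>z. G (u * z + e))"
  using ae_affine[OF assms(1)[unfolded moebius_related_def] assms(2)] by (simp add: moebius_related_def)

lemma moebius_related_deriv:
  assumes F: "F meromorphic_on UNIV" and rel: "moebius_related a b c d F G" and det: "a * d - b * c = 1"
  shows "almost_everywhere (\<lambda>z. deriv G z = deriv F z / (c * F z + d)\<^sup>2)"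
  using ae_nhds[OF rel[unfolded moebius_related_def]] meromorphic_on_imp_analytic_cosparse[OF F]
proof (rule eventually_elim2, goal_cases)
  case (1 z)
  have nz: "c * F z + d \<noteq> 0" using 1 eventually_nhds_x_imp_x by fast
  have "(F has_field_derivative deriv F z) (at z)"
    using 1 by (simp add: analytic_on_imp_differentiable_at field_differentiable_derivI)
  hence "((\<lambda>z. (a * F z + b) / (c * F z + d)) has_field_derivative
      (a * deriv F z * (c * F z + d) - (a * F z + b) * (c * deriv F z)) / ((c * F z + d) * (c * F z + d))) (at z)"
    using nz by (auto intro!: derivative_eq_intros)
  also have "a * deriv F z * (c * F z + d) - (a * F z + b) * (c * deriv F z) = (a * d - b * c) * deriv F z"
    by (simp add: algebra_simps)
  finally have "((\<lambda>z. (a * F z + b) / (c * F z + d)) has_field_derivative deriv F z / (c * F z + d)\<^sup>2) (at z)"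
    by (simp add: det power2_eq_square)
  moreover have "\<forall>\<^sub>F w in nhds z. G w = (a * F w + b) / (c * F w + d)"
    using 1(1) by eventually_elim auto
  hence "deriv G z = deriv (\<lambda>z. (a * F z + b) / (c * F z + d)) z" by (rule deriv_cong_ev) simp
  ultimately show ?case by (simp add: DERIV_imp_deriv)
qed

lemma moebius_related_loc_injective:
  assumes "loc_injective F" "moebius_related a b c d F G" "a * d - b * c = 1" "G meromorphic_on UNIV"
  shows "loc_injective G"
proof -
  have F: "F meromorphic_on UNIV" "almost_everywhere (\<lambda>z. deriv F z \<noteq> 0)"
    using assms(1) by (auto simp: loc_injective_def)
  have "almost_everywhere (\<lambda>z. deriv G z \<noteq> 0)"
    using eventually_conj[OF moebius_related_deriv[OF F(1) assms(2,3)]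
        eventually_conj[OF F(2) assms(2)[unfolded moebius_related_def]]]
    by eventually_elim auto
  thus ?thesis using assms(4) by (simp add: loc_injective_def)
qed

lemma post_moebius_nicely_meromorphic:
  assumes "F meromorphic_on UNIV"
  shows "post_moebius a b c d F nicely_meromorphic_on UNIV"
  unfolding post_moebius_def moebius_def
  by (intro remove_sings_nicely_meromorphic meromorphic_intros assms)

lemma post_moebius_related:
  assumes "loc_injective F" "a * d - b * c = 1"
  shows "moebius_related a b c d F (post_moebius a b c d F)"
proof -
  have "almost_everywhere (\<lambda>z. post_moebius a b c d F z = moebius a b c d (F z))"
    unfolding post_moebius_def
    by (rule eventually_remove_sings_eq) 
       (use assms in \<open>auto simp: moebius_def loc_injective_def intro!: meromorphic_intros\<close>)
  moreover have "almost_everywhere (\<lambda>z. c * F z + d \<noteq> 0)"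
    by (rule loc_injective_linear_avoid) (use assms in auto)
  ultimately show ?thesis unfolding moebius_related_def
    by eventually_elim (auto simp: moebius_def)
qed

lemma post_moebius_loc_injective:
  assumes "loc_injective F" "a * d - b * c = 1"
  shows "loc_injective (post_moebius a b c d F)"
  using moebius_related_loc_injective[OF assms(1) post_moebius_related[OF assms] assms(2)]
    post_moebius_nicely_meromorphic[of F] assms(1)
  by (auto simp: loc_injective_def nicely_meromorphic_on_def)

lemma moebius_related_imp_post_moebius:
  assumes "loc_injective F" "a * d - b * c = 1" "moebius_related a b c d F G" "G nicely_meromorphic_on UNIV"
  shows "G = post_moebius a b c d F"
proof (rule nicely_meromorphic_ae_eq)
  show "almost_everywhere (\<lambda>z. G z = post_moebius a b c d F z)"
    using assms(3) post_moebius_related[OF assms(1,2)] unfolding moebius_related_def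
    by eventually_elim auto
qed (use assms post_moebius_nicely_meromorphic in \<open>auto simp: loc_injective_def\<close>)

text \<open>Cross-multiplication gives a polynomial in \<open>F z\<close> that vanishes on an open
  set of values, hence identically, so the two matrices are proportional. Equal determinants leave
  only the factors 1 and -1.\<close>

lemma moebius_related_unique:
  assumes F: "loc_injective F" and rel: "moebius_related a b c d F G" "moebius_related a' b' c' d' F G"
    and det: "a * d - b * c = 1" "a' * d' - b' * c' = 1"
  shows "(a', b', c', d') = (a, b, c, d) \<or> (a', b', c', d') = (- a, - b, - c, - d)"
proof -
  have ae: "almost_everywhere (\<lambda>z. (a * F z + b) * (c' * F z + d') = (a' * F z + b') * (c * F z + d))"
    using rel unfolding moebius_related_def by eventually_elim (metis frac_eq_eq)
  obtain W where W: "open W" "W \<noteq> {}"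
      "\<And>w. w \<in> W \<Longrightarrow> (a * w + b) * (c' * w + d') = (a' * w + b') * (c * w + d)"
    using loc_injective_open_values[where P = "\<lambda>w. (a * w + b) * (c' * w + d') = (a' * w + b') * (c * w + d)",
        OF F ae] by blast
  define p where "p = [:b, a:] * [:d', c':] - [:b', a':] * [:d, c:]"
  have "W \<subseteq> {w. poly p w = 0}" using W(3) by (auto simp: p_def algebra_simps)
  hence "infinite {w. poly p w = 0}"
    using W(1,2) using finite_imp_not_open finite_subset by blast
  hence "p = 0" using poly_roots_finite by blast
  hence "[:b, a:] * [:d', c':] = [:b', a':] * [:d, c:]" by (simp add: p_def)
  hence e: "b * d' = b' * d" "a * d' + b * c' = a' * d + b' * c" "a * c' = a' * c"
    by (auto simp: algebra_simps)
  \<comment> \<open>If the primed matrix is \<open>s\<close> times the other, then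
    \<open>d * a' - b * c' = s * (a * d - b * c)\<close>, which identifies \<open>s\<close> without
    division.\<close>
  define s where "s = d * a' - b * c'"
  have s2: "s = a * d' - c * b'" using e(2) by (simp add: s_def algebra_simps)
  have "s * a = (a * d - b * c) * a'" unfolding s_def using e(3) by algebra
  moreover have "s * b = (a * d - b * c) * b'" unfolding s2 using e(1) by algebra
  moreover have "s * c = (a * d - b * c) * c'" unfolding s_def using e(3) by algebra
  moreover have "s * d = (a * d - b * c) * d'" unfolding s2 using e(1) by algebra
  ultimately have eq: "a' = s * a" "b' = s * b" "c' = s * c" "d' = s * d" using det(1) by simp_all
  have "s * s * (a * d - b * c) = 1" using det(2) unfolding eq by (simp add: algebra_simps)
  hence "s * s = 1" using det(1) by simp
  hence "s = 1 \<or> s = -1" by (simp add: square_eq_1_iff)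
  thus ?thesis using eq by auto
qed

section \<open>The Schwarzian derivative\<close>

text \<open>The solution is \<open>y = 1 / sqrt F'\<close>. A disc is simply connected, so
  \<open>F' = exp g\<close> there, and \<open>y = exp (- g / 2)\<close> is a holomorphic choice of
  the root. In terms of \<open>g\<close> the Schwarzian is \<open>g'' - g'^2 / 2\<close>.\<close>

lemma schwarzian_linear_equation:
  assumes F: "F holomorphic_on ball z0 r" and nz: "\<And>z. z \<in> ball z0 r \<Longrightarrow> deriv F z \<noteq> 0"
  obtains y y' where
    "\<And>z. z \<in> ball z0 r \<Longrightarrow> (y has_field_derivative y' z) (at z)"
    "\<And>z. z \<in> ball z0 r \<Longrightarrow> (y' has_field_derivative - (schwarzian F z / 2) * y z) (at z)"
    "\<And>z. z \<in> ball z0 r \<Longrightarrow> deriv F z * (y z)\<^sup>2 = 1"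
proof -
  let ?B = "ball z0 r"
  have "deriv F holomorphic_on ?B" using F by (simp add: holomorphic_deriv)
  then obtain g where g: "g holomorphic_on ?B" "\<And>z. z \<in> ?B \<Longrightarrow> deriv F z = exp (g z)"
    using contractible_imp_holomorphic_log[of "deriv F" ?B] nz
    by (metis convex_ball convex_imp_contractible)
  have dg: "(g has_field_derivative deriv g z) (at z)" if "z \<in> ?B" for z
    using g(1) that by (meson holomorphic_derivI open_ball)
  have ddg: "(deriv g has_field_derivative deriv (deriv g) z) (at z)" if "z \<in> ?B" for z
    using g(1) that by (meson holomorphic_deriv holomorphic_derivI open_ball)
  have cong: "deriv f z = deriv h z" if "z \<in> ?B" "\<And>w. w \<in> ?B \<Longrightarrow> f w = h w" for f h :: "complex \<Rightarrow> complex" and z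
    by (rule deriv_cong_ev) (use that in \<open>auto simp: eventually_nhds intro!: exI[of _ ?B]\<close>)
  have d2: "deriv (deriv F) z = deriv g z * exp (g z)" if "z \<in> ?B" for z
  proof -
    have "deriv (deriv F) z = deriv (\<lambda>z. exp (g z)) z" using that g(2) by (rule cong)
    also have "\<dots> = deriv g z * exp (g z)"
      by (rule DERIV_imp_deriv) (use dg[OF that] in \<open>auto intro!: derivative_eq_intros\<close>)
    finally show ?thesis .
  qed
  have d3: "deriv (deriv (deriv F)) z = (deriv (deriv g) z + (deriv g z)\<^sup>2) * exp (g z)" if "z \<in> ?B" for z
  proof -
    have "deriv (deriv (deriv F)) z = deriv (\<lambda>z. deriv g z * exp (g z)) z" using that d2 by (rule cong)
    also have "\<dots> = (deriv (deriv g) z + (deriv g z)\<^sup>2) * exp (g z)"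
      by (rule DERIV_imp_deriv)
         (use dg[OF that] ddg[OF that] in \<open>auto intro!: derivative_eq_intros simp: algebra_simps power2_eq_square\<close>)
    finally show ?thesis .
  qed
  have S: "schwarzian F z = deriv (deriv g) z - (deriv g z)\<^sup>2 / 2" if "z \<in> ?B" for z
    using that by (simp add: schwarzian_def eval_nat_numeral d2 d3 g(2) field_simps)
  show ?thesis
  proof (rule that[of "\<lambda>z. exp (- g z / 2)" "\<lambda>z. - deriv g z / 2 * exp (- g z / 2)"])
    fix z assume z: "z \<in> ?B"
    show "((\<lambda>z. exp (- g z / 2)) has_field_derivative - deriv g z / 2 * exp (- g z / 2)) (at z)"
      by (auto intro!: derivative_eq_intros dg z)
    show "((\<lambda>z. - deriv g z / 2 * exp (- g z / 2)) has_field_derivative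
        - (schwarzian F z / 2) * exp (- g z / 2)) (at z)"
      unfolding S[OF z]
      by (rule derivative_eq_intros dg ddg z refl | simp)+ (simp add: field_simps power2_eq_square)
    have "(exp (- g z / 2))\<^sup>2 = exp (- g z)" by (simp flip: exp_double)
    thus "deriv F z * (exp (- g z / 2))\<^sup>2 = 1" using g(2)[OF z] by (simp flip: exp_add)
  qed
qed

text \<open>
  Solutions \<open>y\<close>, \<open>v\<close> of \<open>y'' = - (S / 2) y\<close> with \<open>F' y\<^sup>2 = 1\<close> and \<open>G' v\<^sup>2 = 1\<close>
  give the solutions \<open>F y\<close> and \<open>G v\<close> of the same equation; the coefficients of the
  transformation are the (constant) Wronskians of \<open>v\<close>, \<open>G v\<close> against \<open>y\<close>, \<open>F y\<close>.
\<close>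
lemma schwarzian_eq_imp_moebius_ball:
  assumes r: "r > 0"
    and F: "F holomorphic_on ball z0 r" "\<And>z. z \<in> ball z0 r \<Longrightarrow> deriv F z \<noteq> 0"
    and G: "G holomorphic_on ball z0 r" "\<And>z. z \<in> ball z0 r \<Longrightarrow> deriv G z \<noteq> 0"
    and S: "\<And>z. z \<in> ball z0 r \<Longrightarrow> schwarzian F z = schwarzian G z"
  obtains a b c d where "a * d - b * c = 1"
    "\<And>z. z \<in> ball z0 r \<Longrightarrow> G z * (c * F z + d) = a * F z + b"
proof -
  let ?B = "ball z0 r"
  obtain y y' where y: "\<And>z. z \<in> ?B \<Longrightarrow> (y has_field_derivative y' z) (at z)"
    "\<And>z. z \<in> ?B \<Longrightarrow> (y' has_field_derivative - (schwarzian F z / 2) * y z) (at z)"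
    "\<And>z. z \<in> ?B \<Longrightarrow> deriv F z * (y z)\<^sup>2 = 1"
    using schwarzian_linear_equation[OF F] by blast
  obtain v v' where v: "\<And>z. z \<in> ?B \<Longrightarrow> (v has_field_derivative v' z) (at z)"
    "\<And>z. z \<in> ?B \<Longrightarrow> (v' has_field_derivative - (schwarzian G z / 2) * v z) (at z)"
    "\<And>z. z \<in> ?B \<Longrightarrow> deriv G z * (v z)\<^sup>2 = 1"
    using schwarzian_linear_equation[OF G] by blast
  have dF: "(F has_field_derivative deriv F z) (at z)" and dG: "(G has_field_derivative deriv G z) (at z)"
    if "z \<in> ?B" for z
    using F(1) G(1) that by (meson holomorphic_derivI open_ball)+
  have yv: "y z \<noteq> 0" "v z \<noteq> 0" if "z \<in> ?B" for z using y(3) v(3) that by force+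
  have const: "h z = h z0" if "z \<in> ?B" "\<And>z. z \<in> ?B \<Longrightarrow> (h has_field_derivative 0) (at z)" for h :: "complex \<Rightarrow> complex" and z
  proof (rule has_field_derivative_zero_constant[of ?B h, THEN exE])
    fix k assume "\<forall>x\<in>?B. h x = k"
    thus ?thesis using that(1) r by simp
  qed (use that in \<open>auto intro: has_field_derivative_at_within\<close>)
  define W where "W = v z0 * y' z0 - v' z0 * y z0"
  have W: "v z * y' z - v' z * y z = W" if "z \<in> ?B" for z
    unfolding W_def using that
    by (rule const) (rule derivative_eq_intros y v refl | simp add: S algebra_simps)+
  \<comment> \<open>By \<open>F' y^2 = 1\<close>, the Wronskian of \<open>v\<close> against
    \<open>F y\<close> is \<open>F W + v / y\<close>. In the same way \<open>G v\<close> has the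
    Wronskian \<open>G W - y / v\<close> against \<open>y\<close>, and then
    \<open>F W2 + G v / y\<close> against \<open>F y\<close>. Eliminating \<open>v / y\<close> from
    the formulas for \<open>X\<close> and \<open>X2\<close> gives the Moebius relation.\<close>
  define X where "X = F z0 * W + v z0 / y z0"
  have X: "F z * W + v z / y z = X" if "z \<in> ?B" for z
    unfolding X_def using that
  proof (rule const)
    fix z assume z: "z \<in> ?B"
    have "((\<lambda>z. F z * W + v z / y z) has_field_derivative
        deriv F z * W + (v' z * y z - v z * y' z) / (y z * y z)) (at z)"
      by (auto intro!: derivative_eq_intros dF y v z yv)
    also have "v' z * y z - v z * y' z = - W" using W[OF z] by (simp add: algebra_simps)
    also have "deriv F z * W + - W / (y z * y z) = 0"
      using y(3)[OF z] yv[OF z] by (simp add: field_simps power2_eq_square)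
    finally show "((\<lambda>z. F z * W + v z / y z) has_field_derivative 0) (at z)" .
  qed
  define W2 where "W2 = G z0 * W - y z0 / v z0"
  have W2: "G z * W - y z / v z = W2" if "z \<in> ?B" for z
    unfolding W2_def using that
  proof (rule const)
    fix z assume z: "z \<in> ?B"
    have "((\<lambda>z. G z * W - y z / v z) has_field_derivative
        deriv G z * W - (y' z * v z - y z * v' z) / (v z * v z)) (at z)"
      by (auto intro!: derivative_eq_intros dG y v z yv)
    also have "y' z * v z - y z * v' z = W" using W[OF z] by (simp add: algebra_simps)
    also have "deriv G z * W - W / (v z * v z) = 0"
      using v(3)[OF z] yv[OF z] by (simp add: field_simps power2_eq_square)
    finally show "((\<lambda>z. G z * W - y z / v z) has_field_derivative 0) (at z)" .
  qed
  define X2 where "X2 = F z0 * W2 + G z0 * v z0 / y z0"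
  have X2: "F z * W2 + G z * v z / y z = X2" if "z \<in> ?B" for z
    unfolding X2_def using that
  proof (rule const)
    fix z assume z: "z \<in> ?B"
    have "((\<lambda>z. F z * W2 + G z * v z / y z) has_field_derivative
        deriv F z * W2 + ((deriv G z * v z + G z * v' z) * y z - G z * v z * y' z) / (y z * y z)) (at z)"
      by (rule derivative_eq_intros dF dG y v z yv refl | simp add: algebra_simps)+
    also have "(deriv G z * v z + G z * v' z) * y z - G z * v z * y' z
        = deriv G z * v z * y z - G z * (v z * y' z - v' z * y z)" by (simp add: algebra_simps)
    also have "\<dots> = - W2"
      unfolding W[OF z] W2[OF z, symmetric] using v(3)[OF z] yv[OF z]
      by (simp add: field_simps power2_eq_square)
    also have "deriv F z * W2 + - W2 / (y z * y z) = 0"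
      using y(3)[OF z] yv[OF z] by (simp add: field_simps power2_eq_square)
    finally show "((\<lambda>z. F z * W2 + G z * v z / y z) has_field_derivative 0) (at z)" .
  qed
  have z0: "z0 \<in> ?B" using r by simp
  show ?thesis
  proof (rule that[of "- W2" X X2 "- W"])
    have "(- W2) * X - X2 * (- W) = (v z0 / y z0) * (G z0 * W - W2)"
      unfolding X_def X2_def by (simp add: algebra_simps add_divide_distrib)
    also have "\<dots> = 1" unfolding W2_def using yv[OF z0] by simp
    finally show "(- W2) * X - X2 * (- W) = 1" .
  next
    fix z assume z: "z \<in> ?B"
    show "G z * (- W * F z + X) = - W2 * F z + X2"
      unfolding X[OF z, symmetric] X2[OF z, symmetric] by (simp add: algebra_simps)
  qed
qed

text \<open>The transformation found on one small disc persists: the cross-multiplied difference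
  \<open>h\<close> is meromorphic, so it vanishes almost everywhere or is nonzero almost everywhere,
  and the disc excludes the latter.\<close>

lemma schwarzian_eq_imp_moebius_related:
  assumes F: "loc_injective F" and G: "loc_injective G"
    and S: "almost_everywhere (\<lambda>z. schwarzian F z = schwarzian G z)"
  obtains a b c d where "a * d - b * c = 1" "moebius_related a b c d F G"
proof -
  have mero: "F meromorphic_on UNIV" "G meromorphic_on UNIV"
    using F G by (auto simp: loc_injective_def)
  define Q where "Q = (\<lambda>z. F analytic_on {z} \<and> G analytic_on {z} \<and> deriv F z \<noteq> 0 \<and> deriv G z \<noteq> 0
    \<and> schwarzian F z = schwarzian G z)"
  have "almost_everywhere Q"
    using F G S by (auto simp: Q_def loc_injective_def intro!: eventually_conj meromorphic_on_imp_analytic_cosparse)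
  from ae_nhds[OF this] obtain z0 where "\<forall>\<^sub>F w in nhds z0. Q w"
    by (rule eventually_happens'[rotated, elim_format]) auto
  then obtain r where r: "r > 0" "\<And>w. w \<in> ball z0 r \<Longrightarrow> Q w"
    unfolding eventually_nhds_metric by (metis mem_ball dist_commute)
  have hol: "F holomorphic_on ball z0 r" "G holomorphic_on ball z0 r"
    using r(2) unfolding Q_def by (meson analytic_imp_holomorphic analytic_on_analytic_at)+
  obtain a b c d where det: "a * d - b * c = 1"
    and eq: "\<And>z. z \<in> ball z0 r \<Longrightarrow> G z * (c * F z + d) = a * F z + b"
    by (rule schwarzian_eq_imp_moebius_ball[OF r(1) hol(1) _ hol(2)]) (use r(2) in \<open>auto simp: Q_def\<close>)
  define h where "h = (\<lambda>z. G z * (c * F z + d) - (a * F z + b))"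
  have "h meromorphic_on UNIV" unfolding h_def by (intro meromorphic_intros mero)
  hence "almost_everywhere (\<lambda>z. h z = 0) \<or> almost_everywhere (\<lambda>z. h z \<noteq> 0)"
    by (intro meromorphic_imp_constant_or_avoid) auto
  moreover have "\<not> almost_everywhere (\<lambda>z. h z \<noteq> 0)"
  proof
    assume "almost_everywhere (\<lambda>z. h z \<noteq> 0)"
    hence "eventually (\<lambda>z. h z \<noteq> 0) (at z0)" by (rule ae_at)
    moreover have "eventually (\<lambda>z. z \<in> ball z0 r) (at z0)"
      using r(1) by (intro eventually_at_in_open') auto
    ultimately have "eventually (\<lambda>z. False) (at z0)"
      by eventually_elim (use eq in \<open>auto simp: h_def\<close>)
    thus False by simp
  qed
  ultimately have "almost_everywhere (\<lambda>z. h z = 0)" by blast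
  moreover have "almost_everywhere (\<lambda>z. c * F z + d \<noteq> 0)"
    by (rule loc_injective_linear_avoid[OF F]) (use det in auto)
  ultimately have "moebius_related a b c d F G"
    unfolding moebius_related_def by eventually_elim (simp add: h_def eq_divide_eq)
  thus ?thesis using that det by blast
qed

section \<open>Translations and the reflection acting on developing maps\<close>

lemma higher_deriv_affine:
  fixes F :: "complex \<Rightarrow> complex"
  assumes "F analytic_on {u * z + c}"
  shows "(deriv ^^ n) (\<lambda>z. F (u * z + c)) z = u ^ n * (deriv ^^ n) F (u * z + c)"
proof -
  obtain T where T: "open T" "u * z + c \<in> T" "F holomorphic_on T"
    using assms by (auto simp: analytic_at)
  have "open ((\<lambda>z. u * z + c) -` T)"
    by (intro open_vimage T continuous_intros)
  thus ?thesis
    by (intro higher_deriv_compose_linear'[OF T(3) _ T(1)]) (use T in auto)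
qed

text \<open>The Schwarzian transforms like a quadratic differential and picks up the factor
  \<open>u\<^sup>2\<close>. The condition on \<open>u\<close> therefore admits translations and
  point reflections alike.\<close>

lemma schwarzian_affine:
  assumes "F analytic_on {u * z + c}" "u\<^sup>2 = 1"
  shows "schwarzian (\<lambda>z. F (u * z + c)) z = schwarzian F (u * z + c)"
proof -
  have "u \<noteq> 0" "u ^ 3 = u" using assms(2) by (auto simp: power2_eq_square power3_eq_cube)
  thus ?thesis
    using higher_deriv_affine[OF assms(1), of 1] assms(2)
    by (simp add: schwarzian_def higher_deriv_affine[OF assms(1)] power_divide power_mult_distrib)
qed

lemma loc_injective_affine:
  assumes F: "loc_injective F" and u: "u \<noteq> 0"
  shows "loc_injective (\<lambda>z. F (u * z + c))"
proof -
  have m: "F meromorphic_on UNIV" and d: "almost_everywhere (\<lambda>z. deriv F z \<noteq> 0)"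
    using F by (auto simp: loc_injective_def)
  have "almost_everywhere (\<lambda>z. deriv (\<lambda>z. F (u * z + c)) z \<noteq> 0)"
    using ae_affine[OF eventually_conj[OF d meromorphic_on_imp_analytic_cosparse[OF m]] u, of c]
  proof eventually_elim
    case (elim z)
    thus ?case using higher_deriv_affine[of F u z c 1] u by simp
  qed
  moreover have "(\<lambda>z. F (u * z + c)) meromorphic_on UNIV"
    by (rule meromorphic_on_compose[OF m]) (auto intro!: analytic_intros)
  ultimately show ?thesis by (simp add: loc_injective_def)
qed

text \<open>The value \<open>u = 1\<close> yields the monodromy along a period \<open>e\<close>;
  \<open>u = -1\<close> with \<open>e = 0\<close> yields the matrix that describes
  \<open>F (- z)\<close>.\<close>

lemma moebius_related_affine_if_schwarzian_invariant:
  assumes F: "loc_injective F" and u: "u\<^sup>2 = 1"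
    and S: "almost_everywhere (\<lambda>z. schwarzian F (u * z + e) = schwarzian F z)"
  obtains a b c d where "a * d - b * c = 1" "moebius_related a b c d F (\<lambda>z. F (u * z + e))"
proof -
  have u0: "u \<noteq> 0" using u by auto
  have "F meromorphic_on UNIV" using F by (simp add: loc_injective_def)
  from S ae_affine[OF meromorphic_on_imp_analytic_cosparse[OF this] u0, of e]
  have "almost_everywhere (\<lambda>z. schwarzian F z = schwarzian (\<lambda>z. F (u * z + e)) z)"
    by eventually_elim (simp add: schwarzian_affine u)
  from schwarzian_eq_imp_moebius_related[OF F loc_injective_affine[OF F u0] this] that
  show ?thesis by blast
qed

section \<open>Spherical length elements\<close>

definition spherical_density :: "(complex \<Rightarrow> complex) \<Rightarrow> complex \<Rightarrow> real" where
  "spherical_density F z = 2 * norm (deriv F z) / (1 + (norm (F z))\<^sup>2)"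

text \<open>The factor \<open>|c F + d|^2\<close> cancels between the derivative and the
  denominator. All transforms of \<open>F\<close> thus share the numerator and differ only in a
  Hermitian form in \<open>(F, 1)\<close>.\<close>

lemma spherical_density_moebius:
  assumes F: "F meromorphic_on UNIV" and rel: "moebius_related a b c d F G" and det: "a * d - b * c = 1"
  shows "almost_everywhere (\<lambda>z. spherical_density G z =
    2 * norm (deriv F z) / ((norm (a * F z + b))\<^sup>2 + (norm (c * F z + d))\<^sup>2))"
  using moebius_related_deriv[OF assms] rel[unfolded moebius_related_def]
proof eventually_elim
  case (elim z)
  define n where "n = norm (c * F z + d)"
  have n: "n \<noteq> 0" using elim by (simp add: n_def)
  have "norm (deriv G z) = norm (deriv F z) / n\<^sup>2" "norm (G z) = norm (a * F z + b) / n"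
    using elim by (auto simp: n_def norm_divide norm_power)
  hence "spherical_density G z = (2 * norm (deriv F z) / n\<^sup>2) / (1 + (norm (a * F z + b))\<^sup>2 / n\<^sup>2)"
    by (simp add: spherical_density_def power_divide)
  also have "1 + (norm (a * F z + b))\<^sup>2 / n\<^sup>2 = ((norm (a * F z + b))\<^sup>2 + n\<^sup>2) / n\<^sup>2"
    using n by (simp add: field_simps)
  finally show ?case using n by (simp add: n_def)
qed

section \<open>Liouville's equation for pull-backs of the spherical metric\<close>

lemma has_derivative_norm_square:
  fixes h :: "complex \<Rightarrow> complex"
  assumes "(h has_field_derivative h') (at z)"
  shows "((\<lambda>z. (norm (h z))\<^sup>2) has_derivative (\<lambda>v. 2 * Re (cnj (h z) * h' * v))) (at z)"
proof -
  have d: "(h has_derivative (*) h') (at z)" using assms by (simp add: has_field_derivative_def)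
  have "((\<lambda>z. Re (h z) * Re (h z) + Im (h z) * Im (h z)) has_derivative
      (\<lambda>v. Re (h z) * Re (h' * v) + Re (h' * v) * Re (h z) + (Im (h z) * Im (h' * v) + Im (h' * v) * Im (h z)))) (at z)"
    by (intro has_derivative_add has_derivative_mult has_derivative_Re has_derivative_Im d)
  thus ?thesis unfolding cmod_power2 by (simp add: power2_eq_square algebra_simps)
qed

text \<open>The constant is 0 for \<open>ln |g'|^2\<close> and 1 for \<open>ln (1 + |g|^2)\<close>,
  the two summands of the logarithm of the length element.\<close>

lemma has_derivative_ln_norm_square:
  fixes h :: "complex \<Rightarrow> complex"
  assumes "(h has_field_derivative h') (at z)" "c + (norm (h z))\<^sup>2 > 0"
  shows "((\<lambda>z. ln (c + (norm (h z))\<^sup>2)) has_derivative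
    (\<lambda>v. Re (2 * cnj (h z) * h' / (of_real (c + (norm (h z))\<^sup>2)) * v))) (at z)"
proof -
  let ?N = "c + (norm (h z))\<^sup>2"
  have "((\<lambda>z. c + (norm (h z))\<^sup>2) has_derivative (\<lambda>v. 2 * Re (cnj (h z) * h' * v))) (at z)"
    using has_derivative_add[OF has_derivative_const has_derivative_norm_square[OF assms(1)]] by simp
  from has_derivative_ln[OF assms(2) this]
  have "((\<lambda>z. ln (c + (norm (h z))\<^sup>2)) has_derivative (\<lambda>v. 2 * Re (cnj (h z) * h' * v) * inverse ?N)) (at z)" .
  moreover have "Re (2 * cnj (h z) * h' / of_real ?N * v) = 2 * Re (cnj (h z) * h' * v) * inverse ?N" for v
  proof -
    have "2 * cnj (h z) * h' / of_real ?N * v = of_real (2 * inverse ?N) * (cnj (h z) * h' * v)"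
      by (simp add: divide_inverse)
    also have "Re \<dots> = 2 * inverse ?N * Re (cnj (h z) * h' * v)" by (simp only: times_complex.sel complex_of_real_def) simp
    finally show ?thesis by simp
  qed
  ultimately show ?thesis by simp
qed

text \<open>Each part of the definition is local. This permits a different chart of the sphere near
  the poles of \<open>F\<close>.\<close>

lemma curvature_one_on_local:
  assumes "\<And>z. z \<in> U \<Longrightarrow> \<exists>V. open V \<and> z \<in> V \<and> curvature_one_on V \<rho>"
  shows "curvature_one_on U \<rho>"
proof -
  have loc: "continuous_on U f"
    if "\<And>V. open V \<Longrightarrow> curvature_one_on V \<rho> \<Longrightarrow> continuous_on V f" for f :: "complex \<Rightarrow> real"
  proof (rule continuous_at_imp_continuous_on, rule ballI)
    fix z assume "z \<in> U"
    then obtain V where "open V" "z \<in> V" "curvature_one_on V \<rho>" using assms by blast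
    thus "isCont f z" using that continuous_on_eq_continuous_at by blast
  qed
  show ?thesis unfolding curvature_one_on_def C2_on_def C1_on_def
  proof (intro conjI allI ballI loc)
    fix z assume "z \<in> U"
    then obtain V where V: "open V" "z \<in> V" "curvature_one_on V \<rho>" using assms by blast
    show "\<rho> z > 0" "(\<lambda>z. ln (\<rho> z)) differentiable at z"
      "laplacian (\<lambda>z. ln (\<rho> z)) z + exp (2 * ln (\<rho> z)) = 0"
      and "\<And>v. dir_deriv v (\<lambda>z. ln (\<rho> z)) differentiable at z"
      using V unfolding curvature_one_on_def C2_on_def C1_on_def by blast+
  qed (auto simp: curvature_one_on_def C2_on_def C1_on_def)
qed

text \<open>Here \<open>ln \<rho> = ln 2 + ln |g'| - ln (1 + |g|^2)\<close>, where
  \<open>ln |g'|\<close> is harmonic, so only the last term contributes to the Laplacian. Both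
  orders of derivatives are computed explicitly because the smoothness condition asks for continuity
  in all directions.\<close>

lemma curvature_one_on_spherical:
  assumes U: "open U" and g: "g holomorphic_on U" and nz: "\<And>z. z \<in> U \<Longrightarrow> deriv g z \<noteq> 0"
    and \<rho>: "\<And>z. z \<in> U \<Longrightarrow> \<rho> z = spherical_density g z"
  shows "curvature_one_on U \<rho>"
proof -
  let ?u = "\<lambda>z. ln (\<rho> z)"
  define g1 where "g1 = deriv g"
  define g2 where "g2 = deriv g1"
  define q where "q = (\<lambda>z. g2 z / g1 z)"
  define q1 where "q1 = deriv q"
  define D where "D = (\<lambda>z. 1 + (norm (g z))\<^sup>2)"
  have D: "D z > 0" for z by (auto simp: D_def intro: add_pos_nonneg)
  hence D0: "D z \<noteq> 0" for z by (metis less_irrefl)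
  have hol1: "g1 holomorphic_on U" unfolding g1_def using g U by (rule holomorphic_deriv)
  have hol2: "g2 holomorphic_on U" unfolding g2_def using hol1 U by (rule holomorphic_deriv)
  have nz1: "g1 z \<noteq> 0" if "z \<in> U" for z using nz that by (simp add: g1_def)
  have holq: "q holomorphic_on U" unfolding q_def by (intro holomorphic_intros hol1 hol2 nz1)
  have holq1: "q1 holomorphic_on U" unfolding q1_def using holq U by (rule holomorphic_deriv)
  have d: "(g has_field_derivative g1 z) (at z)" "(g1 has_field_derivative g2 z) (at z)"
    "(q has_field_derivative q1 z) (at z)" if "z \<in> U" for z
    unfolding g1_def g2_def q1_def using g hol1 holq U that
    by (auto intro!: holomorphic_derivI simp: g1_def)
  have cont: "continuous_on U g" "continuous_on U g1" "continuous_on U g2" "continuous_on U q" "continuous_on U q1"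
    using g hol1 hol2 holq holq1 by (auto intro: holomorphic_on_imp_continuous_on)

  \<comment> \<open>\<open>k\<close> is twice the Wirtinger derivative of \<open>ln \<rho>\<close>
    with respect to \<open>z\<close>, so the differential is
    \<open>v \<mapsto> Re (k z * v)\<close>; \<open>K z\<close> is the real differential of
    \<open>k\<close>.\<close>
  define k where "k = (\<lambda>z. q z - 2 * cnj (g z) * g1 z / of_real (D z))"
  define K where "K = (\<lambda>z w. q1 z * w - 2 * (cnj (g1 z * w) * g1 z + cnj (g z) * (g2 z * w)) / of_real (D z)
    + 4 * cnj (g z) * g1 z * of_real (Re (cnj (g z) * g1 z * w)) / (of_real (D z))\<^sup>2)"

  have u: "(?u has_derivative (\<lambda>v. Re (k z * v))) (at z)" if z: "z \<in> U" for z
  proof -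
    have 1: "((\<lambda>z. ln (0 + (norm (g1 z))\<^sup>2)) has_derivative
        (\<lambda>v. Re (2 * cnj (g1 z) * g2 z / (of_real (0 + (norm (g1 z))\<^sup>2)) * v))) (at z)"
      by (rule has_derivative_ln_norm_square[OF d(2)[OF z]]) (use nz1[OF z] in auto)
    have 2: "((\<lambda>z. ln (1 + (norm (g z))\<^sup>2)) has_derivative
        (\<lambda>v. Re (2 * cnj (g z) * g1 z / (of_real (1 + (norm (g z))\<^sup>2)) * v))) (at z)"
      by (rule has_derivative_ln_norm_square[OF d(1)[OF z]]) (use D in \<open>auto simp: D_def\<close>)
    have qz: "2 * cnj (g1 z) * g2 z / (of_real (0 + (norm (g1 z))\<^sup>2)) = 2 * q z"
      using nz1[OF z] complex_norm_square[of "g1 z"] by (simp add: q_def field_simps)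
    have "((\<lambda>z. ln 2 + 1 / 2 * ln (0 + (norm (g1 z))\<^sup>2) - ln (1 + (norm (g z))\<^sup>2)) has_derivative
        (\<lambda>v. 0 + 1 / 2 * Re (2 * q z * v) - Re (2 * cnj (g z) * g1 z / (of_real (1 + (norm (g z))\<^sup>2)) * v))) (at z)"
      by (intro has_derivative_diff has_derivative_add has_derivative_mult_right has_derivative_const 1[unfolded qz] 2)
    also have "(\<lambda>v. 0 + 1 / 2 * Re (2 * q z * v) - Re (2 * cnj (g z) * g1 z / (of_real (1 + (norm (g z))\<^sup>2)) * v))
        = (\<lambda>v. Re (k z * v))"
      by (simp add: k_def D_def fun_eq_iff algebra_simps)
    finally show ?thesis
    proof (rule has_derivative_transform_within_open[OF _ U z])
      fix w assume w: "w \<in> U"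
      show "ln 2 + 1 / 2 * ln (0 + (norm (g1 w))\<^sup>2) - ln (1 + (norm (g w))\<^sup>2) = ln (\<rho> w)"
        using nz1[OF w] D[of w]
        by (simp add: \<rho>[OF w] spherical_density_def g1_def[symmetric] ln_div ln_mult ln_realpow D_def)
    qed
  qed
  have k: "(k has_derivative K z) (at z)" if z: "z \<in> U" for z
  proof -
    have N: "(D has_derivative (\<lambda>v. 2 * Re (cnj (g z) * g1 z * v))) (at z)"
      unfolding D_def
      using has_derivative_add[OF has_derivative_const has_derivative_norm_square[OF d(1)[OF z]]] by simp
    have dd: "(g has_derivative (*) (g1 z)) (at z)" "(g1 has_derivative (*) (g2 z)) (at z)"
      "(q has_derivative (*) (q1 z)) (at z)"
      using d[OF z] by (simp_all add: has_field_derivative_def)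
    show ?thesis unfolding k_def
      by (rule derivative_eq_intros dd N has_derivative_cnj has_derivative_of_real refl | simp add: D0)+
         (auto simp: K_def fun_eq_iff D0 field_simps power2_eq_square)
  qed

  have du: "dir_deriv v ?u z = Re (k z * v)" if "z \<in> U" for v z
    unfolding dir_deriv_def using frechet_derivative_at[OF u[OF that]] by metis
  have u2: "(dir_deriv v ?u has_derivative (\<lambda>w. Re (K z w * v))) (at z)" if z: "z \<in> U" for v z
  proof -
    have "((\<lambda>z. Re (k z * v)) has_derivative (\<lambda>w. Re (K z w * v))) (at z)"
      by (intro has_derivative_Re has_derivative_mult_left k z)
    thus ?thesis by (rule has_derivative_transform_within_open[OF _ U z]) (simp add: du)
  qed
  have ddu: "dir_deriv w (dir_deriv v ?u) z = Re (K z w * v)" if "z \<in> U" for v w z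
    unfolding dir_deriv_def[of w] using frechet_derivative_at[OF u2[OF that]] by metis
  have contk: "continuous_on U (\<lambda>z. Re (k z * v))" for v
    unfolding k_def D_def by (intro continuous_intros cont) (use D0 in \<open>auto simp: D_def simp flip: of_real_power of_real_add\<close>)
  have contK: "continuous_on U (\<lambda>z. Re (K z w * v))" for v w
    unfolding K_def D_def by (intro continuous_intros cont) (use D0 in \<open>auto simp: D_def simp flip: of_real_power of_real_add\<close>)
  have lap: "laplacian ?u z + exp (2 * ?u z) = 0" if z: "z \<in> U" for z
  proof -
    \<comment> \<open>A complex linear map \<open>w \<mapsto> s * w\<close> contributes
      \<open>s + s * \<i> * \<i> = 0\<close> to this sum. Hence the terms with \<open>q1\<close> and
      \<open>g2\<close> drop out, while the conjugate linear term is doubled.\<close>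
    have "laplacian ?u z = Re (K z 1 + K z \<i> * \<i>)"
      by (simp add: laplacian_def ddu z)
    also have "K z 1 + K z \<i> * \<i> = of_real (- 4 * (norm (g1 z))\<^sup>2 / D z
        + 4 * (norm (g z))\<^sup>2 * (norm (g1 z))\<^sup>2 / (D z)\<^sup>2)"
    proof -
      define p where "p = cnj (g z) * g1 z"
      have "p * of_real (Re p) + p * of_real (Re (p * \<i>)) * \<i> = of_real ((norm p)\<^sup>2)"
        by (simp add: complex_eq_iff cmod_power2) (simp add: power2_eq_square)
      hence p: "p * of_real (Re p) + p * of_real (Re (p * \<i>)) * \<i> = of_real ((norm (g z))\<^sup>2 * (norm (g1 z))\<^sup>2)"
        by (simp add: p_def norm_mult power_mult_distrib)
      have g1: "cnj (g1 z) * g1 z = of_real ((norm (g1 z))\<^sup>2)"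
        using complex_norm_square[of "g1 z"] by (simp add: mult.commute)
      define X Y where "X = p * of_real (Re p)" and "Y = p * of_real (Re (p * \<i>))"
      define \<beta> \<gamma> E E2 where "\<beta> = cnj (g1 z) * g1 z" and "\<gamma> = cnj (g z) * g2 z"
        and "E = inverse (of_real (D z) :: complex)" and "E2 = inverse ((of_real (D z))\<^sup>2 :: complex)"
      have K1: "K z 1 = q1 z - 2 * (\<beta> + \<gamma>) * E + 4 * X * E2"
        by (simp add: K_def X_def p_def \<beta>_def \<gamma>_def E_def E2_def divide_inverse mult.assoc)
      have Ki: "K z \<i> = q1 z * \<i> - 2 * (- \<i> * \<beta> + \<gamma> * \<i>) * E + 4 * Y * E2"
        by (simp add: K_def Y_def p_def \<beta>_def \<gamma>_def E_def E2_def divide_inverse mult_ac)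
      have "K z 1 + K z \<i> * \<i> = - 4 * \<beta> * E + 4 * (X + Y * \<i>) * E2"
        unfolding K1 Ki by (simp add: algebra_simps)
      hence "K z 1 + K z \<i> * \<i> = - 4 * (cnj (g1 z) * g1 z) / of_real (D z)
          + 4 * (p * of_real (Re p) + p * of_real (Re (p * \<i>)) * \<i>) / (of_real (D z))\<^sup>2"
        by (simp add: X_def Y_def \<beta>_def E_def E2_def divide_inverse)
      thus ?thesis unfolding p g1 by simp
    qed
    also have "Re (of_real (- 4 * (norm (g1 z))\<^sup>2 / D z + 4 * (norm (g z))\<^sup>2 * (norm (g1 z))\<^sup>2 / (D z)\<^sup>2))
        = - (4 * (norm (g1 z))\<^sup>2 / (D z)\<^sup>2)"
    proof -
      have n: "(norm (g z))\<^sup>2 = D z - 1" by (simp add: D_def)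
      show ?thesis unfolding n Re_complex_of_real using D0[of z] by (simp add: field_simps power2_eq_square)
    qed
    also have "4 * (norm (g1 z))\<^sup>2 / (D z)\<^sup>2 = (\<rho> z)\<^sup>2"
      by (simp add: \<rho>[OF z] spherical_density_def g1_def D_def power_divide power_mult_distrib)
    also have "(\<rho> z)\<^sup>2 = exp (2 * ?u z)"
    proof -
      have "\<rho> z > 0" using nz[OF z] D[of z] by (simp add: \<rho>[OF z] spherical_density_def D_def)
      thus ?thesis by (simp add: exp_double)
    qed
    finally show ?thesis by simp
  qed
  show ?thesis unfolding curvature_one_on_def C2_on_def C1_on_def
  proof (intro conjI allI ballI)
    fix z assume z: "z \<in> U"
    show "\<rho> z > 0" using nz[OF z] D[of z] by (simp add: \<rho>[OF z] spherical_density_def D_def)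
    show "?u differentiable at z" using u[OF z] by (auto simp: differentiable_def)
    show "dir_deriv v ?u differentiable at z" for v using u2[OF z] unfolding differentiable_def by blast
  next
    show "continuous_on U (dir_deriv v ?u)" for v
      using contk by (rule continuous_on_eq) (simp add: du)
    show "continuous_on U (dir_deriv w (dir_deriv v ?u))" for v w
      using contK by (rule continuous_on_eq) (simp add: ddu)
  qed (rule lap)
qed

lemma isCont_spherical_density:
  assumes "F analytic_on {z}"
  shows "isCont (spherical_density F) z"
proof -
  have "isCont F z" "isCont (deriv F) z"
    using assms by (auto intro!: analytic_at_imp_isCont analytic_deriv)
  moreover have "1 + (norm (F z))\<^sup>2 \<noteq> 0" by (smt (verit) zero_le_power2)
  ultimately show ?thesis unfolding spherical_density_def by (intro continuous_intros)
qed

text \<open>Both sides are continuous on \<open>U\<close>, so they agree at every point of it, and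
  positivity of \<open>\<rho>\<close> then excludes critical points of \<open>g\<close>.\<close>

lemma curvature_one_on_if_ae_spherical_analytic:
  assumes U: "open U" and g: "g analytic_on U"
    and \<rho>: "continuous_on U \<rho>" "\<And>z. z \<in> U \<Longrightarrow> \<rho> z > 0"
    and ae: "\<And>z. z \<in> U \<Longrightarrow> eventually (\<lambda>z. \<rho> z = spherical_density g z) (at z)"
  shows "curvature_one_on U \<rho>"
proof -
  have eq: "\<rho> z = spherical_density g z" if z: "z \<in> U" for z
  proof (rule ae_eq_imp_eq[OF _ _ ae[OF z]])
    show "isCont \<rho> z" using \<rho>(1) U z continuous_on_eq_continuous_at by blast
    show "isCont (spherical_density g) z"
      by (rule isCont_spherical_density) (use g z analytic_on_analytic_at in blast)
  qed
  moreover have "deriv g z \<noteq> 0" if z: "z \<in> U" for z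
    using eq[OF z] \<rho>(2)[OF z] by (auto simp: spherical_density_def)
  ultimately show ?thesis
    using U analytic_imp_holomorphic[OF g] by (intro curvature_one_on_spherical)
qed

lemma curvature_one_on_if_ae_spherical:
  assumes F: "F nicely_meromorphic_on UNIV" "loc_injective F" and U: "open U"
    and \<rho>: "continuous_on U \<rho>" "\<And>z. z \<in> U \<Longrightarrow> \<rho> z > 0"
    and ae: "almost_everywhere (\<lambda>z. \<rho> z = spherical_density F z)"
  shows "curvature_one_on U \<rho>"
proof (rule curvature_one_on_local)
  fix z assume z: "z \<in> U"
  have chart: "\<exists>V. open V \<and> z \<in> V \<and> curvature_one_on V \<rho>"
    if g: "g analytic_on {z}" and ae: "almost_everywhere (\<lambda>z. \<rho> z = spherical_density g z)" for g
  proof -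
    obtain T where T: "open T" "z \<in> T" "g analytic_on T"
      using g analytic_at analytic_on_open by blast
    have "curvature_one_on (T \<inter> U) \<rho>"
    proof (rule curvature_one_on_if_ae_spherical_analytic)
      show "g analytic_on T \<inter> U" using T(3) analytic_on_subset by blast
      show "continuous_on (T \<inter> U) \<rho>" using \<rho>(1) continuous_on_subset by blast
    qed (use T U \<rho> ae_at[OF ae] in auto)
    thus ?thesis using T U z by blast
  qed
  show "\<exists>V. open V \<and> z \<in> V \<and> curvature_one_on V \<rho>"
  proof (cases "is_pole F z")
    case False
    thus ?thesis using chart[OF _ ae] F(1) nicely_meromorphic_on_imp_analytic_at by blast
  next
    case True
    define g where "g = (\<lambda>z. inverse (F z))"
    have "g nicely_meromorphic_on UNIV" unfolding g_def by (intro nicely_meromorphic_on_inverse F)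
    moreover have "\<not> is_pole g z"
    proof -
      have "(g \<longlongrightarrow> 0) (at z)" unfolding g_def
        using True tendsto_inverse_0 unfolding is_pole_def by (rule filterlim_compose[rotated])
      thus ?thesis unfolding is_pole_def using not_tendsto_and_filterlim_at_infinity trivial_limit_at by blast
    qed
    ultimately have g: "g analytic_on {z}" using nicely_meromorphic_on_imp_analytic_at by blast
    \<comment> \<open>The inversion \<open>w \<mapsto> 1 / w\<close> is a rotation of the sphere;
      the entries \<open>\<i>\<close> instead of 1 give its matrix determinant 1.\<close>
    have rel: "moebius_related 0 \<i> \<i> 0 F g"
      unfolding moebius_related_def g_def
      by (rule eventually_mono[OF loc_injective_avoid[OF F(2), of 0]]) (simp add: field_simps)
    have "F meromorphic_on UNIV" using F(2) by (simp add: loc_injective_def)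
    from spherical_density_moebius[OF this rel]
    have "almost_everywhere (\<lambda>z. spherical_density g z = spherical_density F z)"
      by (simp add: spherical_density_def norm_mult)
    with ae have "almost_everywhere (\<lambda>z. \<rho> z = spherical_density g z)"
      by eventually_elim simp
    thus ?thesis by (rule chart[OF g])
  qed
qed

section \<open>Developing maps and isometries of the sphere\<close>

text \<open>Continuity of both sides away from \<open>S\<close> and the poles makes the pointwise
  condition equivalent to one off a discrete set, which can be combined with Moebius
  relations.\<close>

lemma developing_map_iff:
  assumes S: "S sparse_in UNIV" and \<rho>: "continuous_on (- S) \<rho>"
  shows "developing_map S \<rho> F \<longleftrightarrow>
    F nicely_meromorphic_on UNIV \<and> almost_everywhere (\<lambda>z. \<rho> z = spherical_density F z)"
proof (cases "F nicely_meromorphic_on UNIV")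
  case F: True
  hence "F meromorphic_on UNIV" by (simp add: nicely_meromorphic_on_def)
  hence ae: "almost_everywhere (\<lambda>z. z \<in> - S \<and> \<not> is_pole F z)"
    using eventually_not_in_cosparse[OF S] meromorphic_on_imp_not_pole_cosparse
    by (auto intro!: eventually_conj)
  have "open (- S)" using sparse_in_UNIV_imp_closed[OF S] by (rule open_Compl)
  show ?thesis
  proof
    assume "developing_map S \<rho> F"
    with ae show "F nicely_meromorphic_on UNIV \<and> almost_everywhere (\<lambda>z. \<rho> z = spherical_density F z)"
      unfolding developing_map_def spherical_density_def by (auto elim: eventually_mono)
  next
    assume *: "F nicely_meromorphic_on UNIV \<and> almost_everywhere (\<lambda>z. \<rho> z = spherical_density F z)"
    show "developing_map S \<rho> F" unfolding developing_map_def spherical_density_def[symmetric]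
    proof (intro conjI F ballI impI)
      fix z assume z: "z \<in> - S" "\<not> is_pole F z"
      show "\<rho> z = spherical_density F z"
      proof (rule ae_eq_imp_eq)
        show "isCont \<rho> z" using \<rho> z \<open>open (- S)\<close> continuous_on_eq_continuous_at by blast
        show "isCont (spherical_density F) z"
          using F z nicely_meromorphic_on_imp_analytic_at by (intro isCont_spherical_density) blast
      qed (use * ae_at in blast)
    qed
  qed
qed (simp add: developing_map_def)

lemma developing_map_loc_injective:
  assumes "S sparse_in UNIV" "developing_map S \<rho> F" "\<And>z. z \<in> - S \<Longrightarrow> \<rho> z > 0"
  shows "loc_injective F"
proof -
  have mero: "F meromorphic_on UNIV"
    using assms(2) by (simp add: developing_map_def nicely_meromorphic_on_def)
  have "almost_everywhere (\<lambda>z. deriv F z \<noteq> 0)"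
    using eventually_not_in_cosparse[OF assms(1)] meromorphic_on_imp_not_pole_cosparse[OF mero]
  proof eventually_elim
    case (elim z)
    hence "\<rho> z = 2 * norm (deriv F z) / (1 + (norm (F z))\<^sup>2)"
      using assms(2) by (simp add: developing_map_def)
    moreover have "\<rho> z > 0" using elim by (intro assms(3)) simp
    ultimately show ?case by auto
  qed
  thus ?thesis using mero by (simp add: loc_injective_def)
qed

text \<open>A unitary matrix preserves the Hermitian norm of the vector
  \<open>(w, 1)\<close>.\<close>

lemma moebius_unitary:
  fixes a b w :: complex
  assumes "(norm a)\<^sup>2 + (norm b)\<^sup>2 = 1"
  shows "(norm (a * w + b))\<^sup>2 + (norm (- cnj b * w + cnj a))\<^sup>2 = 1 + (norm w)\<^sup>2"
    and "a * cnj a - b * (- cnj b) = 1"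
proof -
  have "of_real ((norm (a * w + b))\<^sup>2 + (norm (- cnj b * w + cnj a))\<^sup>2) =
      of_real ((norm a)\<^sup>2 + (norm b)\<^sup>2) * (1 + of_real ((norm w)\<^sup>2) :: complex)"
    unfolding of_real_add complex_norm_square by (simp add: algebra_simps)
  also have "\<dots> = of_real (1 + (norm w)\<^sup>2)" unfolding assms by simp
  finally show "(norm (a * w + b))\<^sup>2 + (norm (- cnj b * w + cnj a))\<^sup>2 = 1 + (norm w)\<^sup>2"
    by (simp only: of_real_eq_iff)
  have "a * cnj a - b * (- cnj b) = of_real ((norm a)\<^sup>2 + (norm b)\<^sup>2)"
    unfolding of_real_add complex_norm_square by simp
  thus "a * cnj a - b * (- cnj b) = 1" unfolding assms by simp
qed

lemma spherical_density_unitary: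
  assumes "F meromorphic_on UNIV" "moebius_related a b (- cnj b) (cnj a) F G" "(norm a)\<^sup>2 + (norm b)\<^sup>2 = 1"
  shows "almost_everywhere (\<lambda>z. spherical_density G z = spherical_density F z)"
  using spherical_density_moebius[OF assms(1,2) moebius_unitary(2)[OF assms(3)]]
  unfolding moebius_unitary(1)[OF assms(3)] by (simp add: spherical_density_def)

text \<open>Equal length elements mean \<open>|a w + b|^2 + |c w + d|^2 = 1 + |w|^2\<close> for an
  open set of values \<open>w\<close>. A real quadratic polynomial that vanishes on a disc has zero
  coefficients, so the columns of the matrix are orthonormal, and determinant 1 then fixes the
  second row.\<close>

lemma unitary_if_spherical_density_eq:
  assumes F: "loc_injective F" and rel: "moebius_related a b c d F G" and det: "a * d - b * c = 1"
    and eq: "almost_everywhere (\<lambda>z. spherical_density G z = spherical_density F z)"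
  shows "(norm a)\<^sup>2 + (norm b)\<^sup>2 = 1 \<and> c = - cnj b \<and> d = cnj a"
proof -
  define P where "P = (\<lambda>w. (norm (a * w + b))\<^sup>2 + (norm (c * w + d))\<^sup>2 = 1 + (norm w)\<^sup>2)"
  have mero: "F meromorphic_on UNIV" and dF: "almost_everywhere (\<lambda>z. deriv F z \<noteq> 0)"
    using F by (auto simp: loc_injective_def)
  have ae: "almost_everywhere (\<lambda>z. P (F z))"
    using eventually_conj[OF spherical_density_moebius[OF mero rel det] eventually_conj[OF eq
        eventually_conj[OF dF rel[unfolded moebius_related_def]]]]
  proof eventually_elim
    case (elim z)
    define p q where "p = (norm (a * F z + b))\<^sup>2 + (norm (c * F z + d))\<^sup>2" and "q = 1 + (norm (F z))\<^sup>2"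
    have "p > 0" unfolding p_def by (rule add_nonneg_pos) (use elim in auto)
    moreover have "q > 0" unfolding q_def by (rule add_pos_nonneg) auto
    moreover have "2 * norm (deriv F z) / p = 2 * norm (deriv F z) / q" and "norm (deriv F z) \<noteq> 0"
      using elim by (auto simp: p_def q_def spherical_density_def)
    ultimately show ?case unfolding P_def p_def[symmetric] q_def[symmetric] by (simp add: field_simps)
  qed
  obtain W where W: "open W" "W \<noteq> {}" "\<And>w. w \<in> W \<Longrightarrow> P w"
    using loc_injective_open_values[where P = P, OF F ae] by blast
  then obtain w0 r where r: "r > 0" "cball w0 r \<subseteq> W" by (meson ex_in_conv open_contains_cball)
  \<comment> \<open>\<open>A\<close>, \<open>B\<close> and \<open>C\<close> are the entries of the
    Gram matrix of the columns minus the identity, up to conjugation of \<open>B\<close>.\<close>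
  define A where "A = (norm a)\<^sup>2 + (norm c)\<^sup>2 - 1"
  define B where "B = a * cnj b + c * cnj d"
  define C where "C = (norm b)\<^sup>2 + (norm d)\<^sup>2 - 1"
  have P: "P w \<longleftrightarrow> A * (norm w)\<^sup>2 + 2 * Re (B * w) + C = 0" for w
    unfolding P_def A_def B_def C_def cmod_power2 by (simp add: power2_eq_square algebra_simps)
  define Q where "Q = (\<lambda>s. A * (norm (w0 + s))\<^sup>2 + 2 * Re (B * (w0 + s)) + C)"
  have Q: "Q s = Q 0 + A * (norm s)\<^sup>2 + 2 * Re ((A * cnj w0 + B) * s)" for s
    unfolding Q_def cmod_power2 by (simp add: power2_eq_square algebra_simps)
  have Q0: "Q s = 0" if "norm s \<le> r" for s
    using r(2) W(3)[of "w0 + s"] that unfolding P Q_def by (auto simp: dist_norm subset_iff)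
  \<comment> \<open>The points \<open>r\<close> and \<open>- r\<close> isolate the quadratic
    coefficient; \<open>r\<close> and \<open>r * \<i>\<close> then give the real and imaginary parts
    of the linear one.\<close>
  have e: "Q 0 = 0" "Q (of_real r) = 0" "Q (- of_real r) = 0" "Q (of_real r * \<i>) = 0"
    using r(1) by (auto intro!: Q0 simp: norm_mult)
  define Z where "Z = A * cnj w0 + B"
  have "A * r\<^sup>2 + 2 * Re (Z * r) = 0" "A * r\<^sup>2 - 2 * Re (Z * r) = 0"
    using e(1,2,3) unfolding Q[of "of_real r"] Q[of "- of_real r"] Z_def[symmetric] by simp_all
  hence A: "A * r\<^sup>2 = 0" by linarith
  hence A: "A = 0" using r(1) by simp
  have "Re (B * of_real r) = 0" "Re (B * (of_real r * \<i>)) = 0"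
    using e unfolding Q[of "of_real r"] Q[of "of_real r * \<i>"] by (auto simp: A)
  hence B: "B = 0" using r(1) by (auto simp: complex_eq_iff)
  have "C = 0" using e(1) by (simp add: Q_def A B)
  note A = A[unfolded A_def] and B = B[unfolded B_def] and C = \<open>C = 0\<close>[unfolded C_def]
  have bd: "b * cnj b + d * cnj d = 1"
    using arg_cong[OF C, of complex_of_real] by (simp add: complex_norm_square[symmetric] of_real_diff)
  have "cnj d = (a * d - b * c) * cnj d" using det by simp
  also have "\<dots> = a * (b * cnj b + d * cnj d) - b * (a * cnj b + c * cnj d)" by (simp add: algebra_simps)
  finally have d: "cnj d = a" using B bd by simp
  have "cnj b = (a * d - b * c) * cnj b" using det by simp
  also have "\<dots> = d * (a * cnj b + c * cnj d) - c * (b * cnj b + d * cnj d)" by (simp add: algebra_simps)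
  finally have b: "cnj b = - c" using B bd by simp
  have "d = cnj a" using d by (metis complex_cnj_cnj)
  moreover have "norm c = norm b" using b by (metis complex_mod_cnj norm_minus_cancel)
  ultimately show ?thesis using A b by simp
qed

section \<open>Metrics on the torus\<close>

lemma half_period_in_lattice:
  assumes "\<omega> 0 = 0" "\<omega> 2 = \<omega> 1 + \<omega> 3" "j \<le> (3::nat)"
  shows "\<omega> j \<in> lattice (\<omega> 1) (\<omega> 3)"
proof -
  have "j = 0 \<or> j = 1 \<or> j = 2 \<or> j = 3" using assms(3) by auto
  thus ?thesis using assms(1,2) lattice_generators[where ?w1.0 = "\<omega> 1" and ?w3.0 = "\<omega> 3"] by (auto intro: lattice_add)
qed

lemma half_periods_sparse:
  assumes "Im (\<omega> 3 / \<omega> 1) > 0"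
  shows "half_periods \<omega> sparse_in UNIV"
proof -
  have "half_periods \<omega> = (\<Union>j\<in>{..3}. (+) (\<omega> j / 2) ` lattice (\<omega> 1) (\<omega> 3))"
    by (auto simp: half_periods_def)
  thus ?thesis
    using sparse_in_UN_finite[of "{..3::nat}" "\<lambda>j. (+) (\<omega> j / 2) ` lattice (\<omega> 1) (\<omega> 3)" UNIV]
      sparse_in_translate_UNIV[OF sparse_lattice[OF assms]] by simp
qed

lemma half_periods_uminus:
  assumes "\<omega> 0 = 0" "\<omega> 2 = \<omega> 1 + \<omega> 3"
  shows "- z \<in> half_periods \<omega> \<longleftrightarrow> z \<in> half_periods \<omega>"
proof -
  have *: "- z \<in> half_periods \<omega>" if z: "z \<in> half_periods \<omega>" for z
  proof -
    obtain j l where j: "j \<le> 3" "l \<in> lattice (\<omega> 1) (\<omega> 3)" "z = \<omega> j / 2 + l"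
      using z by (auto simp: half_periods_def)
    have "- \<omega> j - l \<in> lattice (\<omega> 1) (\<omega> 3)"
      using j half_period_in_lattice[of \<omega> j] assms by (auto intro: lattice_diff lattice_uminus)
    moreover have "- z = \<omega> j / 2 + (- \<omega> j - l)" by (simp add: j(3) field_simps)
    ultimately show ?thesis unfolding half_periods_def using j(1) by blast
  qed
  show ?thesis using *[of z] *[of "- z"] by auto
qed

lemma spherical_density_affine:
  assumes "F analytic_on {u * z + c}" "norm u = 1"
  shows "spherical_density (\<lambda>z. F (u * z + c)) z = spherical_density F (u * z + c)"
  using higher_deriv_affine[OF assms(1), of 1] assms(2) by (simp add: spherical_density_def norm_mult)

lemma spherical_density_affine_ae:
  assumes F: "F meromorphic_on UNIV" and \<rho>: "almost_everywhere (\<lambda>z. \<rho> z = spherical_density F z)"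
    and u: "norm u = 1"
  shows "almost_everywhere (\<lambda>z. \<rho> (u * z + c) = spherical_density (\<lambda>z. F (u * z + c)) z)"
proof -
  have "u \<noteq> 0" using u by auto
  from ae_affine[OF eventually_conj[OF \<rho> meromorphic_on_imp_analytic_cosparse[OF F]] this, of c]
  show ?thesis by eventually_elim (simp add: spherical_density_affine u)
qed

lemma torus_conic_metricD:
  assumes "torus_conic_metric \<omega> m \<rho>"
  shows "\<And>z. z \<in> - half_periods \<omega> \<Longrightarrow> \<rho> z > 0" "continuous_on (- half_periods \<omega>) \<rho>"
    "\<And>z l. z \<in> - half_periods \<omega> \<Longrightarrow> l \<in> lattice (\<omega> 1) (\<omega> 3) \<Longrightarrow> \<rho> (z + l) = \<rho> z"
proof -
  have *: "\<And>z. z \<in> - half_periods \<omega> \<Longrightarrow> \<rho> z > 0 \<and> (\<lambda>z. ln (\<rho> z)) differentiable (at z)"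
    using assms unfolding torus_conic_metric_def curvature_one_on_def C2_on_def C1_on_def by blast
  show "\<And>z. z \<in> - half_periods \<omega> \<Longrightarrow> \<rho> z > 0" using * by blast
  have "continuous_on (- half_periods \<omega>) (\<lambda>z. exp (ln (\<rho> z)))"
    using * by (intro continuous_on_exp continuous_at_imp_continuous_on ballI differentiable_imp_continuous_within) blast
  thus "continuous_on (- half_periods \<omega>) \<rho>" by (rule continuous_on_eq) (use * in auto)
  show "\<And>z l. z \<in> - half_periods \<omega> \<Longrightarrow> l \<in> lattice (\<omega> 1) (\<omega> 3) \<Longrightarrow> \<rho> (z + l) = \<rho> z"
    using assms by (auto simp: torus_conic_metric_def)
qed

section \<open>An even metric in the equivalence class\<close>

text \<open>
  The Cholesky factor of \<open>I + M\<^sup>* M\<close>, where \<open>M\<close> has rows \<open>(a, b)\<close> and \<open>(c, d)\<close>.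
\<close>
lemma cholesky_identity:
  fixes a b c d w :: complex
  assumes "a * d - b * c = 1"
  defines "p \<equiv> 1 + (norm a)\<^sup>2 + (norm c)\<^sup>2" and "r \<equiv> cnj a * b + cnj c * d"
    and "\<Delta> \<equiv> 2 + (norm a)\<^sup>2 + (norm b)\<^sup>2 + (norm c)\<^sup>2 + (norm d)\<^sup>2"
  shows "p * (1 + (norm w)\<^sup>2 + (norm (a * w + b))\<^sup>2 + (norm (c * w + d))\<^sup>2) = (norm (of_real p * w + r))\<^sup>2 + \<Delta>"
proof -
  let ?p = "1 + a * cnj a + c * cnj c"
  have p: "of_real p = ?p" unfolding p_def of_real_add complex_norm_square by simp
  have "(a * d - b * c) * cnj (a * d - b * c) = 1" using assms(1) by simp
  moreover have "?p * (1 + w * cnj w + (a * w + b) * cnj (a * w + b) + (c * w + d) * cnj (c * w + d))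
    = (?p * w + r) * cnj (?p * w + r) + (1 + a * cnj a + c * cnj c + b * cnj b + d * cnj d
      + (a * d - b * c) * cnj (a * d - b * c))"
    unfolding r_def by (simp add: algebra_simps)
  ultimately have "of_real (p * (1 + (norm w)\<^sup>2 + (norm (a * w + b))\<^sup>2 + (norm (c * w + d))\<^sup>2))
    = (of_real ((norm (of_real p * w + r))\<^sup>2 + \<Delta>) :: complex)"
    unfolding of_real_mult of_real_add complex_norm_square p \<Delta>_def by simp
  thus ?thesis by (simp only: of_real_eq_iff)
qed

text \<open>In terms of \<open>F\<close>, the reciprocals of \<open>\<rho> z\<close> and
  \<open>\<rho> (- z)\<close> are the forms of \<open>I\<close> and \<open>M\<^sup>* M\<close>
  divided by \<open>2 |F'|\<close>. Their sum is symmetric under \<open>z \<mapsto> - z\<close> by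
  construction, and a Cholesky factor of the summed form supplies a developing map for it.\<close>

lemma exists_even_equivalent_metric:
  assumes \<tau>: "Im (\<omega> 3 / \<omega> 1) > 0" and \<omega>: "\<omega> 0 = 0" "\<omega> 2 = \<omega> 1 + \<omega> 3"
    and metric: "torus_conic_metric \<omega> m \<rho>" and dev: "developing_map (half_periods \<omega>) \<rho> F"
    and det: "a * d - b * c = 1" and rel: "moebius_related a b c d F (\<lambda>z. F (- z))"
  obtains \<rho>' where "torus_conic_metric \<omega> m \<rho>'" "equivalent_metrics (half_periods \<omega>) \<rho> \<rho>'"
    "even_metric (half_periods \<omega>) \<rho>'"
proof -
  define S where "S = half_periods \<omega>"
  have sparse: "S sparse_in UNIV" unfolding S_def using \<tau> by (rule half_periods_sparse)
  have Sminus: "- z \<in> S \<longleftrightarrow> z \<in> S" for z unfolding S_def using \<omega> by (rule half_periods_uminus)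
  note \<rho> = torus_conic_metricD[OF metric, folded S_def]
  have openS: "open (- S)" using sparse_in_UNIV_imp_closed[OF sparse] by (rule open_Compl)
  have F: "loc_injective F" using developing_map_loc_injective[OF sparse dev[folded S_def] \<rho>(1)] .
  have mero: "F meromorphic_on UNIV" using F by (simp add: loc_injective_def)
  have ae\<rho>: "almost_everywhere (\<lambda>z. \<rho> z = spherical_density F z)"
    using developing_map_iff[OF sparse \<rho>(2)] dev by (simp add: S_def)
  \<comment> \<open>\<open>p\<close> and \<open>r\<close> form the first row of
    \<open>I + M\<^sup>* M\<close>, and \<open>\<Delta>\<close> is its determinant: 1, plus the
    trace of \<open>M\<^sup>* M\<close>, plus \<open>|det M|^2 = 1\<close>.\<close>
  define p where "p = 1 + (norm a)\<^sup>2 + (norm c)\<^sup>2"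
  define \<Delta> where "\<Delta> = 2 + (norm a)\<^sup>2 + (norm b)\<^sup>2 + (norm c)\<^sup>2 + (norm d)\<^sup>2"
  define r where "r = cnj a * b + cnj c * d"
  have p: "p > 0" and \<Delta>: "\<Delta> > 0" by (auto simp: p_def \<Delta>_def intro!: add_pos_nonneg)
  \<comment> \<open>The Cholesky factor is proportional to the matrix with rows
    \<open>(p, r)\<close> and \<open>(0, sqrt \<Delta>)\<close>; scaling by \<open>k\<close> gives
    it determinant 1.\<close>
  define k where "k = sqrt (1 / (p * sqrt \<Delta>))"
  have k2: "k\<^sup>2 = 1 / (p * sqrt \<Delta>)" unfolding k_def using p \<Delta> by (intro real_sqrt_pow2) simp
  have k: "k\<^sup>2 * p * sqrt \<Delta> = 1" using p \<Delta> by (simp add: k2)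
  define \<alpha> \<beta> \<delta> :: complex where "\<alpha> = of_real (k * p)" and "\<beta> = of_real k * r" and "\<delta> = of_real (k * sqrt \<Delta>)"
  have det': "\<alpha> * \<delta> - \<beta> * 0 = 1"
    unfolding \<alpha>_def \<delta>_def using k by (simp add: power2_eq_square algebra_simps flip: of_real_mult)
  define H where "H = post_moebius \<alpha> \<beta> 0 \<delta> F"
  have relH: "moebius_related \<alpha> \<beta> 0 \<delta> F H" unfolding H_def using F det' by (rule post_moebius_related)
  have H: "loc_injective H" "H nicely_meromorphic_on UNIV"
    unfolding H_def using F det' mero by (auto intro: post_moebius_loc_injective post_moebius_nicely_meromorphic)
  \<comment> \<open>The forms \<open>I\<close> and \<open>M\<^sup>* M\<close> have determinant 1,
    their sum has determinant \<open>\<Delta>\<close>. The factor \<open>sqrt \<Delta>\<close>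
    restores determinant 1 and thereby curvature 1.\<close>
  define \<rho>' where "\<rho>' = (\<lambda>z. sqrt \<Delta> * inverse (inverse (\<rho> z) + inverse (\<rho> (- z))))"
  have quad: "1 + (norm w)\<^sup>2 + ((norm (a * w + b))\<^sup>2 + (norm (c * w + d))\<^sup>2) =
      sqrt \<Delta> * ((norm (\<alpha> * w + \<beta>))\<^sup>2 + (norm (0 * w + \<delta>))\<^sup>2)" for w
  proof -
    have \<alpha>\<beta>: "\<alpha> * w + \<beta> = of_real k * (of_real p * w + r)" by (simp add: \<alpha>_def \<beta>_def algebra_simps)
    have "(norm (\<alpha> * w + \<beta>))\<^sup>2 + (norm (0 * w + \<delta>))\<^sup>2 = k\<^sup>2 * ((norm (of_real p * w + r))\<^sup>2 + \<Delta>)"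
      unfolding \<alpha>\<beta> norm_mult using \<Delta> by (simp add: \<delta>_def norm_mult power_mult_distrib) (simp add: algebra_simps)
    also have "(norm (of_real p * w + r))\<^sup>2 + \<Delta> = p * (1 + (norm w)\<^sup>2 + (norm (a * w + b))\<^sup>2 + (norm (c * w + d))\<^sup>2)"
      using cholesky_identity[OF det, of w] by (simp add: p_def \<Delta>_def r_def)
    finally have "sqrt \<Delta> * ((norm (\<alpha> * w + \<beta>))\<^sup>2 + (norm (0 * w + \<delta>))\<^sup>2) =
      (k\<^sup>2 * p * sqrt \<Delta>) * (1 + (norm w)\<^sup>2 + (norm (a * w + b))\<^sup>2 + (norm (c * w + d))\<^sup>2)"
      by (simp only: mult_ac)
    thus ?thesis unfolding k by (simp only: mult_1 add_ac)
  qed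
  have ae\<rho>m: "almost_everywhere (\<lambda>z. \<rho> (- z) = spherical_density (\<lambda>z. F (- z)) z)"
    using spherical_density_affine_ae[OF mero ae\<rho>, of "-1" 0] by simp
  have ae\<rho>': "almost_everywhere (\<lambda>z. \<rho>' z = spherical_density H z)"
    using eventually_conj[OF ae\<rho> eventually_conj[OF ae\<rho>m
        eventually_conj[OF spherical_density_moebius[OF mero rel det] spherical_density_moebius[OF mero relH det']]]]
  proof eventually_elim
    case (elim z)
    define N Q R where "N = 2 * norm (deriv F z)" and "Q = 1 + (norm (F z))\<^sup>2"
      and "R = (norm (a * F z + b))\<^sup>2 + (norm (c * F z + d))\<^sup>2"
    define T where "T = (norm (\<alpha> * F z + \<beta>))\<^sup>2 + (norm (0 * F z + \<delta>))\<^sup>2"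
    have "\<rho> z = N / Q" "\<rho> (- z) = N / R" using elim by (auto simp: N_def Q_def R_def spherical_density_def)
    hence "\<rho>' z = sqrt \<Delta> * inverse (Q / N + R / N)" by (simp add: \<rho>'_def)
    also have "Q / N + R / N = sqrt \<Delta> * T / N"
      using quad[of "F z"] by (simp add: Q_def R_def T_def flip: add_divide_distrib)
    also have "sqrt \<Delta> * inverse (sqrt \<Delta> * T / N) = N / T" using \<Delta> by simp
    also have "\<dots> = spherical_density H z" using elim by (simp add: N_def T_def)
    finally show ?case .
  qed
  have cont: "continuous_on (- S) \<rho>'" and pos: "\<And>z. z \<in> - S \<Longrightarrow> \<rho>' z > 0"
  proof -
    have "continuous_on (- S) (\<lambda>z. \<rho> (- z))"
      by (rule continuous_on_compose2[OF \<rho>(2)]) (auto intro!: continuous_intros simp: Sminus)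
    moreover have *: "inverse (\<rho> z) + inverse (\<rho> (- z)) > 0" if "z \<in> - S" for z
      using \<rho>(1)[of z] \<rho>(1)[of "- z"] that by (auto simp: Sminus intro!: add_pos_pos)
    moreover have "\<rho> z \<noteq> 0" "\<rho> (- z) \<noteq> 0" "inverse (\<rho> z) + inverse (\<rho> (- z)) \<noteq> 0" if "z \<in> - S" for z
      using \<rho>(1)[of z] \<rho>(1)[of "- z"] *[of z] that by (auto simp: Sminus)
    ultimately show "continuous_on (- S) \<rho>'" unfolding \<rho>'_def using \<rho>(2)
      by (intro continuous_intros) auto
    show "\<And>z. z \<in> - S \<Longrightarrow> \<rho>' z > 0" using * \<Delta> by (simp add: \<rho>'_def)
  qed
  have "torus_conic_metric \<omega> m \<rho>'"
    unfolding torus_conic_metric_def S_def[symmetric]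
  proof (intro conjI ballI allI impI)
    fix z l assume z: "z \<in> - S" and l: "l \<in> lattice (\<omega> 1) (\<omega> 3)"
    show "\<rho>' (z + l) = \<rho>' z"
      using \<rho>(3)[OF z l] \<rho>(3)[of "- z" "- l"] z l lattice_uminus by (simp add: \<rho>'_def Sminus)
  next
    show "curvature_one_on (- S) \<rho>'"
      by (rule curvature_one_on_if_ae_spherical[OF H(2,1) openS cont pos ae\<rho>'])
  next
    fix j :: nat assume j: "j \<le> 3"
    define q where "q = \<omega> j / 2"
    define t where "t = (\<lambda>z. norm (z - q) powr (real (m j) - 1))"
    have "conic_point \<rho> q (real (m j))" using metric j by (simp add: torus_conic_metric_def q_def)
    then obtain C where C: "C > 0" "((\<lambda>z. \<rho> z / t z) \<longlongrightarrow> C) (at q)"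
      by (auto simp: conic_point_def t_def)
    \<comment> \<open>The reflection \<open>z \<mapsto> \<omega> j - z\<close> fixes
      \<open>q\<close> and differs from \<open>z \<mapsto> - z\<close> by a period. Hence
      \<open>\<rho> (- z)\<close> has the same exponent and the same constant \<open>C\<close> at
      \<open>q\<close>, and the harmonic sum keeps the cone angle.\<close>
    have "filterlim (\<lambda>z. \<omega> j - z) (at q) (at q)"
      by (rule filterlim_atI) (auto intro!: tendsto_eq_intros simp: q_def eventually_at_filter)
    from filterlim_compose[OF C(2) this]
    have "((\<lambda>z. \<rho> (\<omega> j - z) / t (\<omega> j - z)) \<longlongrightarrow> C) (at q)" .
    moreover have "eventually (\<lambda>z. \<rho> (\<omega> j - z) / t (\<omega> j - z) = \<rho> (- z) / t z) (at q)"
      using ae_at[OF eventually_not_in_cosparse[OF sparse]]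
    proof eventually_elim
      case (elim z)
      have "\<omega> j - z - q = - (z - q)" by (simp add: q_def field_simps)
      hence "t (\<omega> j - z) = t z" unfolding t_def by (metis norm_minus_cancel)
      moreover have "\<rho> (\<omega> j - z) = \<rho> (- z)"
        using \<rho>(3)[of "- z" "\<omega> j"] elim half_period_in_lattice[of \<omega>, OF \<omega> j] by (simp add: Sminus)
      ultimately show ?case by simp
    qed
    ultimately have C': "((\<lambda>z. \<rho> (- z) / t z) \<longlongrightarrow> C) (at q)"
      by (rule Lim_transform_eventually)
    have "((\<lambda>z. sqrt \<Delta> * inverse (inverse (\<rho> z / t z) + inverse (\<rho> (- z) / t z)))
        \<longlongrightarrow> sqrt \<Delta> * inverse (inverse C + inverse C)) (at q)"
      by (intro tendsto_intros C C') (use C in auto)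
    moreover have "eventually (\<lambda>z. sqrt \<Delta> * inverse (inverse (\<rho> z / t z) + inverse (\<rho> (- z) / t z)) = \<rho>' z / t z) (at q)"
    proof -
      have "inverse (\<rho> z / t z) + inverse (\<rho> (- z) / t z) = t z * (inverse (\<rho> z) + inverse (\<rho> (- z)))" for z
        by (simp add: divide_inverse algebra_simps)
      thus ?thesis by (auto simp: \<rho>'_def divide_inverse mult_ac)
    qed
    ultimately have "((\<lambda>z. \<rho>' z / t z) \<longlongrightarrow> sqrt \<Delta> * inverse (inverse C + inverse C)) (at q)"
      by (rule Lim_transform_eventually)
    moreover have "sqrt \<Delta> * inverse (inverse C + inverse C) > 0" using C(1) \<Delta> by simp
    ultimately show "conic_point \<rho>' (\<omega> j / 2) (real (m j))"
      unfolding conic_point_def t_def q_def by blast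
  qed
  moreover have "equivalent_metrics S \<rho> \<rho>'"
    unfolding equivalent_metrics_def PSL2_related_def
  proof (intro exI conjI)
    show "developing_map S \<rho> F" using dev by (simp add: S_def)
    show "developing_map S \<rho>' H" using developing_map_iff[OF sparse cont] H(2) ae\<rho>' by blast
    show "\<alpha> * \<delta> - \<beta> * 0 = 1" by (rule det')
  qed (simp add: H_def)
  moreover have "even_metric S \<rho>'"
    by (simp add: even_metric_def \<rho>'_def add.commute)
  ultimately show ?thesis using that by (simp add: S_def)
qed

section \<open>The reflection under monodromy of type (A)\<close>

lemma nicely_meromorphic_on_translate:
  assumes "f nicely_meromorphic_on UNIV"
  shows "(\<lambda>z. f (z + c)) nicely_meromorphic_on UNIV"
  unfolding nicely_meromorphic_on_def
proof (intro conjI ballI)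
  show "(\<lambda>z. f (z + c)) meromorphic_on UNIV"
    by (rule meromorphic_on_compose[of f UNIV])
       (use assms in \<open>auto simp: nicely_meromorphic_on_def intro!: analytic_intros\<close>)
  fix z
  have lim: "filterlim (\<lambda>z. z + c) (at (z + c)) (at z)"
    by (rule filterlim_atI) (auto intro!: tendsto_intros simp: eventually_at_filter)
  have "is_pole f (z + c) \<and> f (z + c) = 0 \<or> f \<midarrow>z + c\<rightarrow> f (z + c)"
    using assms by (simp add: nicely_meromorphic_on_def)
  thus "is_pole (\<lambda>z. f (z + c)) z \<and> f (z + c) = 0 \<or> (\<lambda>z. f (z + c)) \<midarrow>z\<rightarrow> f (z + c)"
    unfolding is_pole_def using filterlim_compose[OF _ lim] by blast
qed

text \<open>Conjugating the matrix of the reflection by \<open>w \<mapsto> - w\<close> and by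
  \<open>w \<mapsto> 1 / w\<close> reproduces it up to sign. The first makes it diagonal or
  antidiagonal; the second makes the two remaining entries equal up to sign, so determinant 1 forces
  them to have modulus 1.\<close>

lemma unitary_if_monodromy_A:
  assumes G: "loc_injective G" and mono: "monodromy_A \<omega> G"
    and det: "a * d - b * c = 1" and rel: "moebius_related a b c d G (\<lambda>z. G (- z))"
  shows "(norm a)\<^sup>2 + (norm b)\<^sup>2 = 1 \<and> c = - cnj b \<and> d = cnj a"
proof -
  have G1: "G (z + \<omega> 1) = - G z" and G3: "G (z + \<omega> 3) = 1 / G z" for z
    using mono by (auto simp: monodromy_A_def)
  have G1': "G (- (z + \<omega> 1)) = - G (- z)" for z using G1[of "- (z + \<omega> 1)"] by simp
  have G3': "G (- (z + \<omega> 3)) = 1 / G (- z)" for z using G3[of "- (z + \<omega> 3)"] by simp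
  have "moebius_related a (- b) (- c) d G (\<lambda>z. G (- z))"
    using ae_affine[OF rel[unfolded moebius_related_def] one_neq_zero, of "\<omega> 1"] unfolding moebius_related_def
  proof eventually_elim
    case (elim z)
    hence "- c * G z + d \<noteq> 0" "- G (- z) = (- a * G z + b) / (- c * G z + d)"
      unfolding mult_1 G1 G1' by auto
    moreover from this(2) have "G (- z) = - ((- a * G z + b) / (- c * G z + d))"
      by (metis minus_minus)
    hence "G (- z) = (a * G z + - b) / (- c * G z + d)" by (simp add: minus_divide_left)
    ultimately show ?case by blast
  qed
  from moebius_related_unique[OF G rel this det]
  have case1: "b = 0 \<and> c = 0 \<or> a = 0 \<and> d = 0" using det by auto
  have ba: "b \<noteq> 0 \<or> a \<noteq> 0" using det by auto
  have "moebius_related d c b a G (\<lambda>z. G (- z))"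
    using eventually_conj[OF ae_affine[OF rel[unfolded moebius_related_def] one_neq_zero, of "\<omega> 3"]
      eventually_conj[OF loc_injective_avoid[OF G, of 0] 
        eventually_conj[OF rel[unfolded moebius_related_def] loc_injective_linear_avoid[OF G ba]]]]
    unfolding moebius_related_def
  proof eventually_elim
    case (elim z)
    hence nz: "G z \<noteq> 0" "b * G z + a \<noteq> 0" using det by auto
    have "c * (1 / G z) + d \<noteq> 0" "1 / G (- z) = (a * (1 / G z) + b) / (c * (1 / G z) + d)"
      using elim unfolding mult_1 G3 G3' by auto
    moreover have "c * (1 / G z) + d = (d * G z + c) / G z" "a * (1 / G z) + b = (b * G z + a) / G z"
      using nz by (auto simp: field_simps)
    ultimately have "1 / G (- z) = (b * G z + a) / (d * G z + c)" using nz by simp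
    hence "inverse (1 / G (- z)) = inverse ((b * G z + a) / (d * G z + c))" by simp
    thus ?case using nz by simp
  qed
  from moebius_related_unique[OF G rel this det] det
  have case2: "d = a \<and> c = b \<or> d = - a \<and> c = - b" by (auto simp: algebra_simps)
  have nrm: "norm x = 1" if "x * x = 1 \<or> - (x * x) = 1" for x :: complex
  proof -
    have "(norm x)\<^sup>2 = 1" using that by (metis norm_minus_cancel norm_mult norm_one power2_eq_square)
    thus ?thesis by (simp add: abs_square_eq_1)
  qed
  have cnj: "y = cnj x" if "norm x = 1" "x * y = 1" for x y :: complex
  proof -
    have "x * cnj x = 1" using that(1) by (simp flip: complex_norm_square)
    thus ?thesis using that by (metis mult_left_cancel mult_zero_left zero_neq_one)
  qed
  from case1 show ?thesis
  proof
    assume "b = 0 \<and> c = 0"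
    moreover have "norm a = 1" by (rule nrm) (use case2 det calculation in auto)
    ultimately show ?thesis using cnj[of a d] det by simp
  next
    assume "a = 0 \<and> d = 0"
    moreover have "norm b = 1" by (rule nrm) (use case2 det calculation in auto)
    ultimately show ?thesis using cnj[of b "- c"] det by simp (metis minus_minus)
  qed
qed

section \<open>Unitary monodromy and its normal forms\<close>

text \<open>A matrix in SU(2) is determined by its first row. Thus \<open>b = 0\<close> means a
  diagonal and \<open>a = 0\<close> an antidiagonal matrix.\<close>

definition unitary_related :: "complex \<Rightarrow> complex \<Rightarrow> (complex \<Rightarrow> complex) \<Rightarrow> (complex \<Rightarrow> complex) \<Rightarrow> bool" where
  "unitary_related a b F G \<longleftrightarrow> (norm a)\<^sup>2 + (norm b)\<^sup>2 = 1 \<and> moebius_related a b (- cnj b) (cnj a) F G"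

lemma moebius_related_sl2_compose:
  assumes "moebius_related a b c d F G" "moebius_related a' b' c' d' G H"
    and det: "a * d - b * c = 1" "a' * d' - b' * c' = 1"
  obtains a'' b'' c'' d'' where "a'' * d'' - b'' * c'' = 1" "moebius_related a'' b'' c'' d'' F H"
proof (rule that[OF _ moebius_related_compose[OF assms(1,2)]])
  have "(a' * a + b' * c) * (c' * b + d' * d) - (a' * b + b' * d) * (c' * a + d' * c) =
      (a' * d' - b' * c') * (a * d - b * c)" by (simp add: algebra_simps)
  thus "(a' * a + b' * c) * (c' * b + d' * d) - (a' * b + b' * d) * (c' * a + d' * c) = 1" by (simp add: det)
qed

lemma unitary_related_inverse:
  assumes "unitary_related a b F G"
  shows "unitary_related (cnj a) (- b) G F"
  using assms moebius_related_inverse[of a b "- cnj b" "cnj a" F G] moebius_unitary(2)[of a b]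
  by (simp add: unitary_related_def)

lemma unitary_related_compose:
  assumes "unitary_related a b F G" "unitary_related a' b' G H"
  shows "unitary_related (a' * a - b' * cnj b) (a' * b + b' * cnj a) F H"
proof -
  have "of_real ((norm (a' * a - b' * cnj b))\<^sup>2 + (norm (a' * b + b' * cnj a))\<^sup>2) =
      (of_real (((norm a)\<^sup>2 + (norm b)\<^sup>2) * ((norm a')\<^sup>2 + (norm b')\<^sup>2)) :: complex)"
    unfolding of_real_mult of_real_add complex_norm_square by (simp add: algebra_simps)
  hence "(norm (a' * a - b' * cnj b))\<^sup>2 + (norm (a' * b + b' * cnj a))\<^sup>2 =
      ((norm a)\<^sup>2 + (norm b)\<^sup>2) * ((norm a')\<^sup>2 + (norm b')\<^sup>2)"
    by (metis of_real_eq_iff)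
  moreover have "moebius_related (a' * a - b' * cnj b) (a' * b + b' * cnj a)
      (- cnj (a' * b + b' * cnj a)) (cnj (a' * a - b' * cnj b)) F H"
    using moebius_related_compose[of a b "- cnj b" "cnj a" F G a' b' "- cnj b'" "cnj a'" H] assms
    by (simp add: unitary_related_def algebra_simps)
  ultimately show ?thesis using assms by (simp add: unitary_related_def)
qed

lemma unitary_related_translate:
  assumes "unitary_related a b F G"
  shows "unitary_related a b (\<lambda>z. F (z + c)) (\<lambda>z. G (z + c))"
  using moebius_related_affine[of a b "- cnj b" "cnj a" F G 1 c] assms by (simp add: unitary_related_def)

text \<open>This is the first row of \<open>U A U^{-1}\<close>, where \<open>A\<close> has first row
  \<open>(a, b)\<close> and \<open>U\<close> has first row \<open>(x, y)\<close>: a change of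
  developing map conjugates the monodromy.\<close>

lemma unitary_related_conjugate:
  assumes "unitary_related a b G (\<lambda>z. G (z + c))" "unitary_related x y G H"
  shows "unitary_related (x * (a * cnj x + b * cnj y) - y * cnj (b * x - a * y))
    (x * (b * x - a * y) + y * cnj (a * cnj x + b * cnj y)) H (\<lambda>z. H (z + c))"
  using unitary_related_compose[OF unitary_related_compose[OF unitary_related_inverse[OF assms(2)] assms(1)]
      unitary_related_translate[OF assms(2), of c]] by (simp add: algebra_simps)

text \<open>The second condition is the vanishing of the off-diagonal entry of the conjugated
  matrix. The root \<open>w\<close> is a fixed point of the given rotation of the sphere, and
  \<open>(x, y)\<close>, proportional to \<open>(1, - w)\<close>, describes a rotation that moves it
  to 0.\<close>

lemma diagonalize_unitary:
  fixes a b :: complex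
  obtains x y where "(norm x)\<^sup>2 + (norm y)\<^sup>2 = 1" "x * (b * x - a * y) + y * cnj (a * cnj x + b * cnj y) = 0"
proof (cases "b = 0")
  case True
  thus ?thesis using that[of 1 0] by simp
next
  case False
  define s where "s = csqrt ((a - cnj a)\<^sup>2 - 4 * cnj b * b)"
  define w where "w = (s - (a - cnj a)) / (2 * cnj b)"
  have s: "s\<^sup>2 = (a - cnj a)\<^sup>2 - 4 * cnj b * b" by (simp add: s_def)
  have "2 * cnj b * w = s - (a - cnj a)" using False by (simp add: w_def)
  hence "(2 * cnj b * w + (a - cnj a))\<^sup>2 = (a - cnj a)\<^sup>2 - 4 * cnj b * b" using s by simp
  hence "4 * cnj b * (cnj b * w\<^sup>2 + (a - cnj a) * w + b) = 0" by algebra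
  hence root: "cnj b * w\<^sup>2 + (a - cnj a) * w + b = 0" using False by simp
  define x where "x = 1 / sqrt (1 + (norm w)\<^sup>2)"
  have n: "1 + (norm w)\<^sup>2 > 0" by (auto intro: add_pos_nonneg)
  have x2: "x\<^sup>2 = 1 / (1 + (norm w)\<^sup>2)" using n by (simp add: x_def power_divide)
  show ?thesis
  proof (rule that[of "of_real x" "- w * of_real x"])
    have "(norm (complex_of_real x))\<^sup>2 + (norm (- w * of_real x))\<^sup>2 = x\<^sup>2 * (1 + (norm w)\<^sup>2)"
      by (simp add: norm_mult power_mult_distrib algebra_simps)
    thus "(norm (complex_of_real x))\<^sup>2 + (norm (- w * of_real x))\<^sup>2 = 1" using n by (simp add: x2)
    have "of_real x * (b * of_real x - a * (- w * of_real x)) + (- w * of_real x) * cnj (a * cnj (of_real x) + b * cnj (- w * of_real x))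
      = (of_real x)\<^sup>2 * (cnj b * w\<^sup>2 + (a - cnj a) * w + b)"
      by (simp add: algebra_simps power2_eq_square)
    thus "of_real x * (b * of_real x - a * (- w * of_real x)) + (- w * of_real x) * cnj (a * cnj (of_real x) + b * cnj (- w * of_real x)) = 0"
      by (simp add: root)
  qed
qed

text \<open>Both products describe \<open>F (z + w1 + w3)\<close>, and the matrix of such a relation
  is unique up to sign.\<close>

lemma unitary_related_commute:
  assumes F: "loc_injective F"
    and 1: "unitary_related a b F (\<lambda>z. F (z + w1))" and 3: "unitary_related p q F (\<lambda>z. F (z + w3))"
  shows "p * a - q * cnj b = a * p - b * cnj q \<and> p * b + q * cnj a = a * q + b * cnj p \<or>
    p * a - q * cnj b = - (a * p - b * cnj q) \<and> p * b + q * cnj a = - (a * q + b * cnj p)"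
proof -
  have r1: "unitary_related (p * a - q * cnj b) (p * b + q * cnj a) F (\<lambda>z. F (z + w1 + w3))"
    by (rule unitary_related_compose[OF 1 unitary_related_translate[OF 3]])
  have "unitary_related (a * p - b * cnj q) (a * q + b * cnj p) F (\<lambda>z. F (z + w3 + w1))"
    by (rule unitary_related_compose[OF 3 unitary_related_translate[OF 1]])
  hence r2: "unitary_related (a * p - b * cnj q) (a * q + b * cnj p) F (\<lambda>z. F (z + w1 + w3))"
    by (simp add: add_ac)
  show ?thesis
    using moebius_related_unique[OF F, of "a * p - b * cnj q" "a * q + b * cnj p" _ _ "\<lambda>z. F (z + w1 + w3)"
        "p * a - q * cnj b" "p * b + q * cnj a"] r1 r2 moebius_unitary(2)
    unfolding unitary_related_def by blast
qed

text \<open>The multiplier of a diagonal matrix is \<open>e / cnj e\<close>, which equals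
  \<open>e * e\<close> because \<open>|e| = 1\<close>.\<close>

lemma unitary_related_diagonal_translate:
  assumes "unitary_related e 0 F (\<lambda>z. F (z + c))" "F nicely_meromorphic_on UNIV"
  shows "F (z + c) = e * e * F z" "norm (e * e) = 1"
proof -
  have e: "norm e = 1" using assms(1) by (simp add: unitary_related_def abs_square_eq_1)
  hence ee: "e * cnj e = 1" by (simp flip: complex_norm_square)
  show "norm (e * e) = 1" using e by (simp add: norm_mult)
  have "almost_everywhere (\<lambda>z. cnj e \<noteq> 0 \<and> F (z + c) = e * F z / cnj e)"
    using assms(1) by (simp add: unitary_related_def moebius_related_def)
  hence "almost_everywhere (\<lambda>z. F (z + c) = e * e * F z)"
  proof eventually_elim
    case (elim z)
    hence "F (z + c) * cnj e = e * F z" by (auto simp: field_simps)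
    hence "F (z + c) * (e * cnj e) = e * e * F z" by (metis mult.assoc mult.left_commute)
    thus ?case by (simp add: ee)
  qed
  hence "(\<lambda>z. F (z + c)) = (\<lambda>z. e * e * F z)"
    by (intro nicely_meromorphic_ae_eq nicely_meromorphic_on_translate nicely_meromorphic_on_cmult_left assms)
  thus "F (z + c) = e * e * F z" by meson
qed

lemma monodromy_B_if_diagonal:
  assumes "unitary_related e1 0 F (\<lambda>z. F (z + \<omega> 1))" "unitary_related e3 0 F (\<lambda>z. F (z + \<omega> 3))"
    and F: "F nicely_meromorphic_on UNIV"
  shows "monodromy_B \<omega> F"
proof -
  have angle: "exp (2 * of_real pi * \<i> * of_real (Arg w / (2 * pi))) = w" if "norm w = 1" for w
    using Arg_eq[of w] that by (force simp: mult.commute)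
  show ?thesis unfolding monodromy_B_def
    by (rule exI[of _ "\<lambda>j. if j = 1 then Arg (e1 * e1) / (2 * pi) else Arg (e3 * e3) / (2 * pi)"])
       (use unitary_related_diagonal_translate[OF assms(1) F] unitary_related_diagonal_translate[OF assms(2) F]
         angle in auto)
qed

lemma PSU2_relatedI:
  assumes "loc_injective F" "unitary_related a b F G" "G nicely_meromorphic_on UNIV"
  shows "PSU2_related F G"
  unfolding PSU2_related_def
  using moebius_related_imp_post_moebius[OF assms(1) _ _ assms(3)] moebius_unitary(2) assms(2)
  unfolding unitary_related_def by blast

lemma exists_unitary_related:
  assumes F: "loc_injective F" and ab: "(norm a)\<^sup>2 + (norm b)\<^sup>2 = 1"
  obtains G where "unitary_related a b F G" "loc_injective G" "G nicely_meromorphic_on UNIV"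
proof -
  note det = moebius_unitary(2)[OF ab]
  show ?thesis
    using that[of "post_moebius a b (- cnj b) (cnj a) F"] post_moebius_related[OF F det]
      post_moebius_loc_injective[OF F det] post_moebius_nicely_meromorphic F ab
    by (auto simp: unitary_related_def loc_injective_def)
qed

text \<open>Once the first monodromy is diagonal, the second is also diagonal, or the first is
  trivial, or the two anticommute. The first two possibilities lead to (B), the last to (A).\<close>

lemma monodromy_normalization:
  assumes F: "loc_injective F" "F nicely_meromorphic_on UNIV"
    and 1: "unitary_related a b F (\<lambda>z. F (z + \<omega> 1))" and 3: "unitary_related p q F (\<lambda>z. F (z + \<omega> 3))"
  obtains G where "PSU2_related F G" "monodromy_A \<omega> G \<or> monodromy_B \<omega> G"
proof -
  obtain x y where xy: "(norm x)\<^sup>2 + (norm y)\<^sup>2 = 1" "x * (b * x - a * y) + y * cnj (a * cnj x + b * cnj y) = 0"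
    by (rule diagonalize_unitary)
  obtain G where G: "unitary_related x y F G" "loc_injective G" "G nicely_meromorphic_on UNIV"
    using exists_unitary_related[OF F(1) xy(1)] .
  define e where "e = x * (a * cnj x + b * cnj y) - y * cnj (b * x - a * y)"
  obtain p' q' where G3: "unitary_related p' q' G (\<lambda>z. G (z + \<omega> 3))"
    using unitary_related_conjugate[OF 3 G(1)] by blast
  have G1: "unitary_related e 0 G (\<lambda>z. G (z + \<omega> 1))"
    using unitary_related_conjugate[OF 1 G(1)] unfolding xy(2) e_def .
  have "(norm e)\<^sup>2 = 1" using G1 by (simp add: unitary_related_def)
  hence e: "e * cnj e = 1" by (metis complex_norm_square of_real_1)
  hence e0: "e \<noteq> 0" by auto
  from unitary_related_commute[OF G(2) G1 G3]
  \<comment> \<open>The entries compared are \<open>p' * e\<close> with \<open>e * p'\<close> and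
    \<open>q' * cnj e\<close> with \<open>e * q'\<close>, up to a common sign.\<close>
  consider "q' = 0" | "q' \<noteq> 0" "cnj e = e" | "p' = 0" "cnj e = - e"
  proof (elim disjE conjE, goal_cases)
    case 1
    thus ?case by (cases "q' = 0") (auto simp: mult.commute)
  next
    case 2
    hence "p' = 0" using e0 by (simp add: eq_neg_iff_add_eq_0 mult.commute flip: mult_2)
    moreover have "q' \<noteq> 0" using G3 calculation by (auto simp: unitary_related_def)
    moreover have "q' * (cnj e + e) = 0" using 2 by (simp add: algebra_simps)
    ultimately show ?case using 2 by (simp add: eq_neg_iff_add_eq_0)
  qed
  thus ?thesis
  proof cases
    case 1
    thus ?thesis using that[of G] monodromy_B_if_diagonal[of e G \<omega> p'] G G1 G3 PSU2_relatedI[OF F(1)] by blast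
  next
    case 2
    obtain x y where xy: "(norm x)\<^sup>2 + (norm y)\<^sup>2 = 1" "x * (q' * x - p' * y) + y * cnj (p' * cnj x + q' * cnj y) = 0"
      by (rule diagonalize_unitary)
    obtain H where H: "unitary_related x y G H" "loc_injective H" "H nicely_meromorphic_on UNIV"
      using exists_unitary_related[OF G(2) xy(1)] .
    \<comment> \<open>With \<open>cnj e = e\<close> the first monodromy matrix is scalar, so it
      stays diagonal under the conjugation that diagonalizes the second.\<close>
    have "x * (0 * x - e * y) + y * cnj (e * cnj x + 0 * cnj y) = 0" using 2 by (simp add: algebra_simps)
    hence H1: "\<exists>e'. unitary_related e' 0 H (\<lambda>z. H (z + \<omega> 1))"
      using unitary_related_conjugate[OF G1 H(1)] by metis
    moreover have "\<exists>e'. unitary_related e' 0 H (\<lambda>z. H (z + \<omega> 3))"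
      using unitary_related_conjugate[OF G3 H(1)] unfolding xy(2) by blast
    ultimately have "monodromy_B \<omega> H" using monodromy_B_if_diagonal H(3) by blast
    thus ?thesis using that[of H] PSU2_relatedI[OF F(1) unitary_related_compose[OF G(1) H(1)] H(3)] by blast
  next
    case 3
    have q: "norm q' = 1" using G3 3 by (simp add: unitary_related_def abs_square_eq_1)
    \<comment> \<open>Conjugation by the diagonal matrix with first row \<open>(t, 0)\<close>
      multiplies the off-diagonal entry by \<open>t * t\<close>. The value \<open>\<i>\<close> makes
      the second monodromy exactly \<open>w \<mapsto> 1 / w\<close>.\<close>
    define t where "t = csqrt (\<i> / q')"
    have t2: "t * q' * t = \<i>" 
    proof -
      have "t\<^sup>2 * q' = \<i>" using q by (auto simp: t_def)
      thus ?thesis by (simp add: power2_eq_square mult_ac)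
    qed
    have "norm (t * q' * t) = 1" unfolding t2 by simp
    hence t: "norm t = 1" using q by (simp add: norm_mult abs_square_eq_1 flip: power2_eq_square)
    obtain H where H: "unitary_related t 0 G H" "loc_injective H" "H nicely_meromorphic_on UNIV"
      using exists_unitary_related[OF G(2), of t 0] t by auto
    have tt: "t * cnj t = 1" using t by (simp flip: complex_norm_square)
    have te: "t * (e * cnj t) = e" using tt by (metis mult.left_commute mult.right_neutral)
    have "unitary_related e 0 H (\<lambda>z. H (z + \<omega> 1))"
      using unitary_related_conjugate[OF G1 H(1)] by (simp add: te)
    from unitary_related_diagonal_translate(1)[OF this H(3)]
    moreover have "e * e = - 1" using e 3 by (metis minus_minus mult_minus_right)
    ultimately have A1: "H (z + \<omega> 1) = - H z" for z by simp
    have "unitary_related 0 \<i> H (\<lambda>z. H (z + \<omega> 3))"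
      using unitary_related_conjugate[OF G3 H(1)] t2 3 by (simp add: mult_ac)
    hence "almost_everywhere (\<lambda>z. H (z + \<omega> 3) = inverse (H z))"
      unfolding unitary_related_def moebius_related_def
      by (elim conjE eventually_mono) (simp add: field_simps)
    hence "(\<lambda>z. H (z + \<omega> 3)) = (\<lambda>z. inverse (H z))"
      by (intro nicely_meromorphic_ae_eq nicely_meromorphic_on_translate nicely_meromorphic_on_inverse H)
    hence "H (z + \<omega> 3) = 1 / H z" for z by (metis inverse_eq_divide)
    with A1 have "monodromy_A \<omega> H" by (simp add: monodromy_A_def)
    thus ?thesis using that[of H] PSU2_relatedI[OF F(1) unitary_related_compose[OF G(1) H(1)] H(3)] by blast
  qed
qed

section \<open>From the symmetries of the Schwarzian to those of the metric\<close>

theorem theorem1: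
  fixes \<omega> :: "nat \<Rightarrow> complex" and m :: "nat \<Rightarrow> nat" and n b :: "nat \<Rightarrow> complex"
    and lam :: complex and L S :: "complex set"
    and \<rho> :: "complex \<Rightarrow> real" and F :: "complex \<Rightarrow> complex"
  assumes "Im (\<omega> 3 / \<omega> 1) > 0" and "\<omega> 0 = 0" and "\<omega> 2 = \<omega> 1 + \<omega> 3"
    and "L = lattice (\<omega> 1) (\<omega> 3)" and "S = half_periods \<omega>"
    and "\<And>j. j \<le> 3 \<Longrightarrow> m j > 0"
    and "\<And>j. j \<le> 3 \<Longrightarrow> n j = (of_nat (m j) - 1) / 2"
    and "torus_conic_metric \<omega> m \<rho>"
    and "developing_map S \<rho> F"
    and "\<And>z. z \<notin> S \<Longrightarrow> \<not> is_pole F z \<Longrightarrow>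
           schwarzian F z =
             -2 * ((\<Sum>j=0..3. n j * (n j + 1) * weierstrass_p L (z - \<omega> j / 2))
                 + (\<Sum>j=0..3. b j * weierstrass_zeta L (z - \<omega> j / 2)) + lam)"
    and "(\<Sum>j=0..3. b j) = 0"
    and "\<And>j. j \<le> 3 \<Longrightarrow> b j = 0"
  shows "(\<exists>G. PSU2_related F G \<and> (monodromy_A \<omega> G \<or> monodromy_B \<omega> G)) \<and>
         (\<forall>G. PSU2_related F G \<longrightarrow>
            developing_map S \<rho> G \<and>
            (monodromy_A \<omega> G \<longrightarrow> even_metric S \<rho>) \<and>
            (monodromy_B \<omega> G \<longrightarrow>
               (\<exists>\<rho>'. torus_conic_metric \<omega> m \<rho>' \<and> equivalent_metrics S \<rho> \<rho>' \<and>
                     even_metric S \<rho>')))"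
proof -
  note \<tau> = assms(1) and \<omega> = assms(2,3) and L = assms(4) and S = assms(5) and metric = assms(8)
  have sparse: "S sparse_in UNIV" unfolding S using \<tau> by (rule half_periods_sparse)
  have openS: "open (- S)" using sparse_in_UNIV_imp_closed[OF sparse] by (rule open_Compl)
  have Sminus: "- z \<in> S \<longleftrightarrow> z \<in> S" for z unfolding S using \<omega> by (rule half_periods_uminus)
  note \<rho> = torus_conic_metricD[OF metric, folded S L]
  note dev_iff = developing_map_iff[OF sparse \<rho>(2)]
  have F: "loc_injective F" "F nicely_meromorphic_on UNIV"
    and ae\<rho>: "almost_everywhere (\<lambda>z. \<rho> z = spherical_density F z)"
    using developing_map_loc_injective[OF sparse assms(9) \<rho>(1)] dev_iff assms(9) by auto
  have mero: "F meromorphic_on UNIV" using F(1) by (simp add: loc_injective_def)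
  have notS: "almost_everywhere (\<lambda>z. z \<notin> S)" using sparse by (rule eventually_not_in_cosparse)

  define T where "T = (\<lambda>z. -2 * ((\<Sum>j=0..3. n j * (n j + 1) * weierstrass_p L (z - \<omega> j / 2)) + lam))"
  have schw: "almost_everywhere (\<lambda>z. schwarzian F z = T z)"
    using notS meromorphic_on_imp_not_pole_cosparse[OF mero]
  proof eventually_elim
    case (elim z)
    thus ?case using assms(10)[of z] assms(12) by (simp add: T_def)
  qed
  have T_translate: "T (z + e) = T z" if "e \<in> L" for z e
  proof -
    have "weierstrass_p L (z + e - \<omega> j / 2) = weierstrass_p L (z - \<omega> j / 2)" for j
      using weierstrass_p_periodic[OF \<tau>, of e "z - \<omega> j / 2"] that by (simp add: L algebra_simps)
    thus ?thesis by (simp add: T_def)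
  qed
  have T_even: "T (- z) = T z" for z
  proof -
    have "weierstrass_p L (- z - \<omega> j / 2) = weierstrass_p L (z - \<omega> j / 2)" if "j \<le> 3" for j
    proof -
      \<comment> \<open>The reflection moves the pole \<open>\<omega> j / 2\<close> to its negative,
        which differs from it by the period \<open>\<omega> j\<close>.\<close>
      have "weierstrass_p L (- z - \<omega> j / 2) = weierstrass_p L (- (z - \<omega> j / 2 + \<omega> j))"
        by (rule arg_cong[of _ _ "weierstrass_p L"]) (simp add: field_simps)
      also have "\<dots> = weierstrass_p L (z - \<omega> j / 2)"
        unfolding L weierstrass_p_even[OF \<tau>]
        by (rule weierstrass_p_periodic[OF \<tau> half_period_in_lattice[OF \<omega> that]])
      finally show ?thesis .
    qed
    thus ?thesis by (simp add: T_def)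
  qed
  have sym: "\<exists>a b c d. a * d - b * c = 1 \<and> moebius_related a b c d F (\<lambda>z. F (u * z + e))"
    if u: "u\<^sup>2 = 1" and inv: "\<And>z. T (u * z + e) = T z" for u e
  proof -
    have "u \<noteq> 0" using u by auto
    from schw ae_affine[OF schw this, of e]
    have "almost_everywhere (\<lambda>z. schwarzian F (u * z + e) = schwarzian F z)"
      by eventually_elim (simp add: inv)
    from moebius_related_affine_if_schwarzian_invariant[OF F(1) u this] show ?thesis by blast
  qed

  have period: "\<exists>a b. unitary_related a b F (\<lambda>z. F (z + e))" if e: "e \<in> L" for e
  proof -
    obtain a b c d where rel: "a * d - b * c = 1" "moebius_related a b c d F (\<lambda>z. F (z + e))"
      using sym[of 1 e] T_translate[OF e] by auto
    have "almost_everywhere (\<lambda>z. \<rho> (z + e) = spherical_density (\<lambda>z. F (z + e)) z)"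
      using spherical_density_affine_ae[OF mero ae\<rho>, of 1 e] by simp
    \<comment> \<open>Periodicity of \<open>\<rho>\<close> gives \<open>F\<close> and its translate
      the same length element, so the matrix between them is unitary.\<close>
    with ae\<rho> notS have "almost_everywhere (\<lambda>z. spherical_density (\<lambda>z. F (z + e)) z = spherical_density F z)"
      by eventually_elim (use \<rho>(3) e in force)
    from unitary_if_spherical_density_eq[OF F(1) rel(2,1) this] rel(2) show ?thesis
      unfolding unitary_related_def by blast
  qed
  obtain a b p q where "unitary_related a b F (\<lambda>z. F (z + \<omega> 1))" "unitary_related p q F (\<lambda>z. F (z + \<omega> 3))"
    using period lattice_generators unfolding L by metis
  then obtain G where "PSU2_related F G" "monodromy_A \<omega> G \<or> monodromy_B \<omega> G"
    using monodromy_normalization[OF F] by metis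
  moreover have "developing_map S \<rho> G \<and> (monodromy_A \<omega> G \<longrightarrow> even_metric S \<rho>) \<and>
      (monodromy_B \<omega> G \<longrightarrow> (\<exists>\<rho>'. torus_conic_metric \<omega> m \<rho>' \<and> equivalent_metrics S \<rho> \<rho>' \<and> even_metric S \<rho>'))"
    if G: "PSU2_related F G" for G
  proof -
    obtain x y where xy: "(norm x)\<^sup>2 + (norm y)\<^sup>2 = 1" and G_def: "G = post_moebius x y (- cnj y) (cnj x) F"
      using G by (auto simp: PSU2_related_def)
    note det = moebius_unitary(2)[OF xy]
    have relG: "moebius_related x y (- cnj y) (cnj x) F G"
      unfolding G_def by (rule post_moebius_related[OF F(1) det])
    have G: "loc_injective G" "G nicely_meromorphic_on UNIV"
      unfolding G_def using post_moebius_loc_injective[OF F(1) det] post_moebius_nicely_meromorphic[OF mero] by auto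
    have meroG: "G meromorphic_on UNIV" using G(1) by (simp add: loc_injective_def)
    have ae\<rho>G: "almost_everywhere (\<lambda>z. \<rho> z = spherical_density G z)"
      using ae\<rho> spherical_density_unitary[OF mero relG xy] by eventually_elim simp
    obtain a b c d where abcd: "a * d - b * c = 1" "moebius_related a b c d F (\<lambda>z. F (- z))"
      using sym[of "-1" 0] T_even by auto
    have "even_metric S \<rho>" if mono: "monodromy_A \<omega> G"
    proof -
      \<comment> \<open>The matrix of the reflection is carried from \<open>F\<close> to
        \<open>G\<close> through conjugation by the unitary change of developing map.\<close>
      have "moebius_related x y (- cnj y) (cnj x) (\<lambda>z. F (- z)) (\<lambda>z. G (- z))"
        using moebius_related_affine[OF relG, of "-1" 0] by simp
      from moebius_related_sl2_compose[OF abcd(2) this abcd(1) det]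
      obtain a' b' c' d' where *: "a' * d' - b' * c' = 1" "moebius_related a' b' c' d' F (\<lambda>z. G (- z))" .
      have det': "cnj x * x - (- y) * (- (- cnj y)) = 1" using det by (simp add: mult.commute)
      from moebius_related_sl2_compose[OF moebius_related_inverse[OF relG det] *(2) det' *(1)]
      obtain a b c d where rel: "a * d - b * c = 1" "moebius_related a b c d G (\<lambda>z. G (- z))" .
      from unitary_if_monodromy_A[OF G(1) mono this] rel(2)
      have "almost_everywhere (\<lambda>z. spherical_density (\<lambda>z. G (- z)) z = spherical_density G z)"
        using spherical_density_unitary[OF meroG] by metis
      moreover have "almost_everywhere (\<lambda>z. \<rho> (- z) = spherical_density (\<lambda>z. G (- z)) z)"
        using spherical_density_affine_ae[OF meroG ae\<rho>G, of "-1" 0] by simp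
      ultimately have ae: "almost_everywhere (\<lambda>z. \<rho> (- z) = \<rho> z)"
        using ae\<rho>G by eventually_elim simp
      show ?thesis unfolding even_metric_def
      proof
        fix z assume z: "z \<in> - S"
        have cont: "isCont \<rho> w" if "w \<in> - S" for w
          using \<rho>(2) openS that continuous_on_eq_continuous_at by blast
        show "\<rho> (- z) = \<rho> z"
        proof (rule ae_eq_imp_eq[OF _ _ ae_at[OF ae]])
          show "isCont (\<lambda>z. \<rho> (- z)) z"
            by (rule isCont_o2[OF _ cont]) (use z in \<open>auto simp: Sminus\<close>)
        qed (rule cont[OF z])
      qed
    qed
    moreover have "\<exists>\<rho>'. torus_conic_metric \<omega> m \<rho>' \<and> equivalent_metrics S \<rho> \<rho>' \<and> even_metric S \<rho>'"
      using exists_even_equivalent_metric[OF \<tau> \<omega> metric assms(9)[unfolded S] abcd] unfolding S by blast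
    moreover have "developing_map S \<rho> G" using dev_iff G(2) ae\<rho>G by blast
    ultimately show ?thesis by blast
  qed
  ultimately show ?thesis by blast
qed

end
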